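(* Let $P$ be a Markov counting process with intensity $\ell$ (satisfying the standing assumptions below). Assume that for some $\lambda\in\mathbb{R}$ $$\lim_{z\to+\infty}\sup_{t\in[0,1]}|\Xi_\ell(t,z)-\lambda|=0.$$ Then for every $\varepsilon>0$, $$\lim_{N\to+\infty}P^{0N}\Big(\sup_{t\in[0,1]}\Big|\tfrac1N X_t-\pi_\lambda(t)\Big|\ge\varepsilon\Big)=0.$$
   Context: $\Omega$ is the space of càdlàg step functions $\omega:[0,1]\to\mathbb{N}$ with finitely many jumps, all of amplitude $+1$, with no jump at $t=0$ or $t=1$; $X$ is the canonical process. A Markov counting process with intensity $\ell:[0,1]\times\mathbb{N}\to\mathbb{R}_+$ is a probability $P$ on $\Omega$ under which $t\mapsto X_t-X_0-\int_0^t\ell(r,X_{r^-})\,dr$ is a local martingale. Standing assumptions: (i) $t\mapsto\ell(t,z)$ is continuously differentiable on $[0,1]$ for each $z$; (ii) $(t,z)\mapsto\ell(t,z+1)-\ell(t,z)$ is globally bounded above and below; (iii) $\ell>0$ everywhere; the initial law of $P$ has full support on $\mathbb{N}$. $P^{0N}(\cdot)=P(\cdot\mid X_0=0,X_1=N)$. The reciprocal characteristic is $\Xi_\ell(t,z)=\partial_t\log\ell(t,z)+\ell(t,z+1)-\ell(t,z)$. $\pi_\lambda(t)=\frac{e^{\lambda t}-1}{e^{\lambda}-1}$ for $\lambda\neq0$ and $\pi_0(t)=t$. *)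

theory Defs
  imports "HOL-Probability.Probability"
begin

type_synonym path = "real \<Rightarrow> nat"

text \<open>Path space: step functions on [0,1] with finitely many jumps of size +1, all in the
open interval (0,1); a path is represented by a function on all of real, constant before 0
and after the last jump (so it is determined by its restriction to [0,1]).\<close>
definition Omega :: "path set" where
  "Omega = {\<omega>. \<exists>J. finite J \<and> J \<subseteq> {0<..<1} \<and>
                  (\<forall>t. \<omega> t = \<omega> 0 + card {s\<in>J. s \<le> t})}"

definition left_lim :: "path \<Rightarrow> real \<Rightarrow> nat" where
  "left_lim \<omega> r = Lim (at_left r) (\<lambda>s. \<omega> s)"

definition Fgen :: "real \<Rightarrow> path set set" where
  "Fgen t = {{\<omega>\<in>Omega. \<omega> s = k} | s k. s \<in> {0..t}}"

definition Fsig :: "real \<Rightarrow> path set set" where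
  "Fsig t = sigma_sets Omega (Fgen t)"

definition stopping_time01 :: "(path \<Rightarrow> real) \<Rightarrow> bool" where
  "stopping_time01 \<tau> \<longleftrightarrow> (\<forall>\<omega>\<in>Omega. \<tau> \<omega> \<in> {0..1}) \<and>
     (\<forall>t\<in>{0..1}. {\<omega>\<in>Omega. \<tau> \<omega> \<le> t} \<in> Fsig t)"

definition martingale01 :: "path measure \<Rightarrow> (path \<Rightarrow> real \<Rightarrow> real) \<Rightarrow> bool" where
  "martingale01 P M \<longleftrightarrow>
     (\<forall>t\<in>{0..1}. (\<lambda>\<omega>. M \<omega> t) \<in> borel_measurable (sigma Omega (Fgen t))
                \<and> integrable P (\<lambda>\<omega>. M \<omega> t)) \<and>
     (\<forall>s t A. 0 \<le> s \<longrightarrow> s \<le> t \<longrightarrow> t \<le> 1 \<longrightarrow> A \<in> Fsig s \<longrightarrow>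
        (\<integral>\<omega>. indicator A \<omega> * M \<omega> t \<partial>P) = (\<integral>\<omega>. indicator A \<omega> * M \<omega> s \<partial>P))"

definition local_martingale01 :: "path measure \<Rightarrow> (path \<Rightarrow> real \<Rightarrow> real) \<Rightarrow> bool" where
  "local_martingale01 P M \<longleftrightarrow>
     (\<exists>\<tau> :: nat \<Rightarrow> path \<Rightarrow> real.
        (\<forall>n. stopping_time01 (\<tau> n)) \<and>
        (\<forall>\<omega>\<in>Omega. \<forall>n. \<tau> n \<omega> \<le> \<tau> (Suc n) \<omega>) \<and>
        (AE \<omega> in P. \<exists>n. \<tau> n \<omega> = 1) \<and>
        (\<forall>n. martingale01 P (\<lambda>\<omega> t. M \<omega> (min t (\<tau> n \<omega>)))))"

definition counting_process :: "path measure \<Rightarrow> (real \<Rightarrow> nat \<Rightarrow> real) \<Rightarrow> bool" where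
  "counting_process P l \<longleftrightarrow> prob_space P \<and> space P = Omega \<and> sets P = Fsig 1 \<and>
     local_martingale01 P
       (\<lambda>\<omega> t. real (\<omega> t) - real (\<omega> 0) - integral {0..t} (\<lambda>r. l r (left_lim \<omega> r)))"

definition Xi :: "(real \<Rightarrow> nat \<Rightarrow> real) \<Rightarrow> real \<Rightarrow> nat \<Rightarrow> real" where
  "Xi l t z = vector_derivative (\<lambda>s. ln (l s z)) (at t within {0..1})
              + l t (Suc z) - l t z"

definition pi_lam :: "real \<Rightarrow> real \<Rightarrow> real" where
  "pi_lam lam t = (if lam = 0 then t else (exp (lam * t) - 1) / (exp lam - 1))"

definition bridge_prob :: "path measure \<Rightarrow> nat \<Rightarrow> path set \<Rightarrow> real" where
  "bridge_prob P N A =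
     measure P (A \<inter> {\<omega>\<in>Omega. \<omega> 0 = 0 \<and> \<omega> 1 = N}) / measure P {\<omega>\<in>Omega. \<omega> 0 = 0 \<and> \<omega> 1 = N}"

end

theory Submission
  imports Defs
begin

text \<open>
  For \<open>A\<close> in the past of \<open>s\<close>, the local martingale property yields the forward equation for
  \<open>F j t = P (A \<inter> {X\<^sub>t = j})\<close>. After the gauge \<open>q j t = F j t * exp (\<integral>\<^sub>0\<^sup>t l r j dr)\<close> it becomes
  \<open>q\<^sub>j\<^sub>+\<^sub>1' = \<phi>\<^sub>j q\<^sub>j\<close>, where the logarithmic derivative of \<open>\<phi>\<^sub>j\<close> is the reciprocal characteristic
  \<open>\<Xi>(\<cdot>, j)\<close>. If \<open>\<delta>\<^sub>j\<close> bounds \<open>\<bar>\<Xi>(\<cdot>, j) - \<lambda>\<bar>\<close>, then \<open>\<phi>\<^sub>j t\<close> equals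
  \<open>l 0 j * exp (\<lambda> t)\<close> up to a factor \<open>exp (\<plusminus> \<delta>\<^sub>j)\<close>, and solving the chain of equations on \<open>[0, u]\<close> and \<open>[u, 1]\<close>
  shows that the law of \<open>X\<^sub>u\<close> under the bridge from \<open>0\<close> to \<open>N\<close> is
  binomial with parameters \<open>N\<close> and \<open>\<pi>\<^sub>\<lambda> u\<close>, up to a factor \<open>exp (2 (\<delta>\<^sub>0 + \<dots> + \<delta>\<^sub>N\<^sub>-\<^sub>1)) = exp (o(N))\<close>.
  Hoeffding's exponential bound absorbs this factor; monotonicity of paths reduces the
  supremum over \<open>t\<close> to a finite grid.
\<close>

subsection \<open>Paths and compensators\<close>

lemma OmegaE:
  assumes "\<omega> \<in> Omega"
  obtains J where "finite J" "J \<subseteq> {0<..<1}" "\<And>t. \<omega> t = \<omega> 0 + card {s\<in>J. s \<le> t}"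
  using assms unfolding Omega_def by blast

lemma Omega_mono:
  assumes "\<omega> \<in> Omega" "s \<le> t"
  shows "\<omega> s \<le> \<omega> t"
proof -
  obtain J where J: "finite J" "\<And>t. \<omega> t = \<omega> 0 + card {s\<in>J. s \<le> t}"
    using OmegaE[OF assms(1)] by metis
  have "card {r\<in>J. r \<le> s} \<le> card {r\<in>J. r \<le> t}"
    using J(1) assms(2) by (intro card_mono) auto
  then show ?thesis using J(2)[of s] J(2)[of t] by linarith
qed

text \<open>Each of the finitely many jump times is either at most \<open>r\<close> or at a positive
  distance to its right. Serves the joint measurability in time and path.\<close>

lemma Omega_right_constant:
  assumes "\<omega> \<in> Omega"
  shows "eventually (\<lambda>s. \<omega> s = \<omega> r) (at_right r)"
proof -
  obtain J where J: "finite J" "\<And>t. \<omega> t = \<omega> 0 + card {s\<in>J. s \<le> t}"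
    using OmegaE[OF assms(1)] by metis
  have "eventually (\<lambda>s. j \<le> s \<longleftrightarrow> j \<le> r) (at_right r)" for j
  proof (cases "j \<le> r")
    case True
    then show ?thesis by (auto simp: eventually_at_filter)
  next
    case False
    then have "eventually (\<lambda>s. s \<in> {r<..<j}) (at_right r)"
      by (intro eventually_at_right_real) auto
    then show ?thesis by eventually_elim (use False in auto)
  qed
  then have "eventually (\<lambda>s. \<forall>j\<in>J. j \<le> s \<longleftrightarrow> j \<le> r) (at_right r)"
    using J(1) by (intro eventually_ball_finite) auto
  then show ?thesis
  proof eventually_elim
    case (elim s)
    then have "{j\<in>J. j \<le> s} = {j\<in>J. j \<le> r}" by auto
    then show ?case using J(2)[of s] J(2)[of r] by simp
  qed
qed

text \<open>Left limits differ from values only at the jumps, a null set, so inside time integrals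
  the intensity may be evaluated at the path itself.\<close>

lemma Omega_left_lim:
  assumes "\<omega> \<in> Omega"
  obtains J where "finite J" "\<And>r. r \<notin> J \<Longrightarrow> left_lim \<omega> r = \<omega> r"
proof -
  obtain J where J: "finite J" "\<And>t. \<omega> t = \<omega> 0 + card {s\<in>J. s \<le> t}"
    using OmegaE[OF assms(1)] by metis
  have "left_lim \<omega> r = \<omega> r" if "r \<notin> J" for r
  proof -
    have "eventually (\<lambda>s. j \<le> s \<longleftrightarrow> j \<le> r) (at_left r)" if "j \<in> J" for j
    proof (cases "j < r")
      case True
      then have "eventually (\<lambda>s. s \<in> {j<..<r}) (at_left r)"
        by (intro eventually_at_left_real) auto
      then show ?thesis by eventually_elim (use True in auto)
    next
      case False
      with that \<open>r \<notin> J\<close> have "r < j" by (cases "r = j") auto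
      then show ?thesis by (auto simp: eventually_at_filter)
    qed
    then have "eventually (\<lambda>s. \<forall>j\<in>J. j \<le> s \<longleftrightarrow> j \<le> r) (at_left r)"
      using J(1) by (intro eventually_ball_finite) auto
    then have "eventually (\<lambda>s. \<omega> s = \<omega> r) (at_left r)"
    proof eventually_elim
      case (elim s)
      then have "{j\<in>J. j \<le> s} = {j\<in>J. j \<le> r}" by auto
      then show ?case using J(2)[of s] J(2)[of r] by simp
    qed
    then have "(\<omega> \<longlongrightarrow> \<omega> r) (at_left r)"
      by (rule tendsto_eventually)
    then show ?thesis
      unfolding left_lim_def by (intro tendsto_Lim) auto
  qed
  then show ?thesis using that J(1) by blast
qed

text \<open>Finitely many jump times are separated by a positive distance, and a shorter window
  catches at most one of them. A sufficiently fine partition thus sees at most one jump per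
  cell.\<close>

lemma Omega_unit_jumps:
  assumes "\<omega> \<in> Omega"
  obtains d where "d > 0" "\<And>a b. a \<le> b \<Longrightarrow> b - a < d \<Longrightarrow> \<omega> b \<le> \<omega> a + 1"
proof -
  obtain J where J: "finite J" "\<And>t. \<omega> t = \<omega> 0 + card {s\<in>J. s \<le> t}"
    using OmegaE[OF assms(1)] by metis
  \<comment> \<open>The distances between distinct jump times; the inserted 1 keeps the set nonempty
    when there are fewer than two jumps.\<close>
  define D where "D = insert 1 ((\<lambda>(x, y). \<bar>x - y\<bar>) ` {(x, y). x \<in> J \<and> y \<in> J \<and> x \<noteq> y})"
  have "{(x, y). x \<in> J \<and> y \<in> J \<and> x \<noteq> y} \<subseteq> J \<times> J" by auto
  then have fin: "finite D"
    unfolding D_def using J(1) finite_subset[OF _ finite_cartesian_product[OF J(1) J(1)]] by auto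
  have pos: "Min D > 0"
    using fin by (subst Min_gr_iff) (auto simp: D_def)
  have sep: "Min D \<le> \<bar>x - y\<bar>" if "x \<in> J" "y \<in> J" "x \<noteq> y" for x y
    using fin that by (intro Min_le) (auto simp: D_def)
  have "\<omega> b \<le> \<omega> a + 1" if ab: "a \<le> b" "b - a < Min D" for a b
  proof -
    have split: "{j\<in>J. j \<le> b} = {j\<in>J. j \<le> a} \<union> {j\<in>J. a < j \<and> j \<le> b}"
      using ab by auto
    have "card {j\<in>J. a < j \<and> j \<le> b} \<le> Suc 0"
    proof (subst card_le_Suc0_iff_eq)
      show "finite {j\<in>J. a < j \<and> j \<le> b}" using J(1) by auto
      show "\<forall>x\<in>{j\<in>J. a < j \<and> j \<le> b}. \<forall>y\<in>{j\<in>J. a < j \<and> j \<le> b}. x = y"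
      proof (intro ballI, rule ccontr)
        fix x y assume xy: "x \<in> {j\<in>J. a < j \<and> j \<le> b}" "y \<in> {j\<in>J. a < j \<and> j \<le> b}" "x \<noteq> y"
        then have "Min D \<le> \<bar>x - y\<bar>" using sep by auto
        moreover have "\<bar>x - y\<bar> \<le> b - a" using xy by auto
        ultimately show False using ab by linarith
      qed
    qed
    then have "card {j\<in>J. j \<le> b} \<le> card {j\<in>J. j \<le> a} + 1"
      unfolding split using card_Un_le[of "{j\<in>J. j \<le> a}" "{j\<in>J. a < j \<and> j \<le> b}"] by linarith
    then show ?thesis using J(2)[of a] J(2)[of b] by linarith
  qed
  with pos show ?thesis using that by blast
qed

lemma Omega_level_borel:
  assumes "\<omega> \<in> Omega"
  shows "{r. \<omega> r = i} \<in> sets borel"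
proof -
  have "mono (\<lambda>r. real (\<omega> r))"
    using Omega_mono[OF assms] by (intro monoI) auto
  then have "(\<lambda>r. real (\<omega> r)) \<in> borel_measurable borel"
    by (rule borel_measurable_mono)
  then have "(\<lambda>r. real (\<omega> r)) -` {real i} \<inter> space borel \<in> sets borel"
    by (rule measurable_sets) auto
  moreover have "(\<lambda>r. real (\<omega> r)) -` {real i} \<inter> space borel = {r. \<omega> r = i}" by auto
  ultimately show ?thesis by simp
qed

lemma integral_le_bound:
  fixes f :: "real \<Rightarrow> real"
  assumes "f integrable_on {a..b}" "a \<le> b" "\<And>r. r \<in> {a..b} \<Longrightarrow> 0 \<le> f r \<and> f r \<le> L"
  shows "0 \<le> integral {a..b} f \<and> integral {a..b} f \<le> L * (b - a)"
proof -
  have "integral {a..b} f \<le> integral {a..b} (\<lambda>_. L)"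
    using assms by (intro integral_le) auto
  moreover have "0 \<le> integral {a..b} f" using assms by (intro integral_nonneg) auto
  ultimately show ?thesis using assms(2) by (simp add: mult.commute)
qed

section \<open>Occupation rates and compensated processes of a single path\<close>

locale jump_intensity =
  fixes l :: "real \<Rightarrow> nat \<Rightarrow> real"
  assumes l_cont: "\<And>z. continuous_on {0..1} (\<lambda>s. l s z)"
    and l_pos: "\<And>t z. t \<in> {0..1} \<Longrightarrow> l t z > 0"
begin

definition occ :: "nat \<Rightarrow> path \<Rightarrow> real \<Rightarrow> real" where
  "occ i \<omega> r = l r i * of_bool (\<omega> r = i)"

text \<open>The local martingale of the hypothesis, with the path in place of its left limit; by
  \<open>integral_left_lim\<close> the integral is the same.\<close>

definition compensated :: "path \<Rightarrow> real \<Rightarrow> real" where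
  "compensated \<omega> t = real (\<omega> t) - real (\<omega> 0) - integral {0..t} (\<lambda>r. l r (\<omega> r))"

text \<open>Jumps have size one, so \<open>of_bool (i < \<omega> t)\<close> grows exactly when the
  path jumps from \<open>i\<close> to \<open>i + 1\<close>. Up to its initial value this is the
  stochastic integral of the indicator of level \<open>i\<close>, taken at left limits, against
  \<open>compensated\<close>.\<close>

definition compensated_level :: "nat \<Rightarrow> path \<Rightarrow> real \<Rightarrow> real" where
  "compensated_level i \<omega> t = of_bool (i < \<omega> t) - integral {0..t} (occ i \<omega>)"

lemma bound_up_to:
  obtains L where "L > 0" "\<And>r x. r \<in> {0..1} \<Longrightarrow> x \<le> k \<Longrightarrow> l r x \<le> L"
proof -
  have "\<exists>B. \<forall>r\<in>{0..1}. l r x \<le> B" for x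
  proof -
    have "compact ((\<lambda>s. l s x) ` {0..1})"
      by (intro compact_continuous_image l_cont) auto
    then have "bounded ((\<lambda>s. l s x) ` {0..1})" by (rule compact_imp_bounded)
    then obtain B where "\<forall>y\<in>(\<lambda>s. l s x) ` {0..1}. norm y \<le> B" unfolding bounded_iff by blast
    then have "\<forall>r\<in>{0..1}. l r x \<le> B" by (auto simp: abs_le_iff)
    then show ?thesis ..
  qed
  then obtain B where B: "\<And>x r. r \<in> {0..1} \<Longrightarrow> l r x \<le> B x" by metis
  have "l r x \<le> 1 + (\<Sum>y\<le>k. \<bar>B y\<bar>)" if "r \<in> {0..1}" "x \<le> k" for r x
  proof -
    have "\<bar>B x\<bar> \<le> (\<Sum>y\<le>k. \<bar>B y\<bar>)" using that by (intro member_le_sum) auto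
    then show ?thesis using B[OF that(1), of x] by linarith
  qed
  moreover have "0 < 1 + (\<Sum>y\<le>k. \<bar>B y\<bar>)" by (smt (verit) sum_nonneg abs_ge_zero)
  ultimately show ?thesis using that by blast
qed

lemma set_integrable_l: "integrable lborel (\<lambda>r. indicator {0..1} r * l r i)"
  using borel_integrable_compact[OF _ l_cont[of i]] by (simp add: mult.commute)

lemma occ_set_integrable:
  assumes "\<omega> \<in> Omega" "0 \<le> a" "b \<le> 1"
  shows "set_integrable lborel {a..b} (occ i \<omega>)"
proof -
  have "integrable lborel (\<lambda>r. indicator ({a..b} \<inter> {r. \<omega> r = i}) r *\<^sub>R (indicator {0..1} r * l r i))"
    using Omega_level_borel[OF assms(1), of i]
    by (intro integrable_mult_indicator set_integrable_l) auto
  also have "(\<lambda>r. indicator ({a..b} \<inter> {r. \<omega> r = i}) r *\<^sub>R (indicator {0..1} r * l r i)) =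
    (\<lambda>r. indicator {a..b} r *\<^sub>R occ i \<omega> r)"
    using assms by (auto simp: occ_def indicator_def)
  finally show ?thesis unfolding set_integrable_def .
qed

lemma occ_integrable:
  assumes "\<omega> \<in> Omega" "0 \<le> a" "b \<le> 1"
  shows "occ i \<omega> integrable_on {a..b}"
  using set_borel_integral_eq_integral(1)[OF occ_set_integrable[OF assms]] .

text \<open>Up to time 1 the path meets only levels up to \<open>\<omega> 1\<close>, so the
  intensity along it is a finite sum of the functions \<open>occ i \<omega>\<close>.\<close>

lemma path_integrable:
  assumes "\<omega> \<in> Omega" "0 \<le> a" "b \<le> 1"
  shows "(\<lambda>r. l r (\<omega> r)) integrable_on {a..b}"
proof -
  have "(\<lambda>r. \<Sum>i\<le>\<omega> 1. occ i \<omega> r) integrable_on {a..b}"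
    using assms by (intro integrable_sum occ_integrable) auto
  moreover have "(\<Sum>i\<le>\<omega> 1. occ i \<omega> r) = l r (\<omega> r)" if "r \<in> {a..b}" for r
  proof -
    have "\<omega> r \<le> \<omega> 1" using that assms by (intro Omega_mono) auto
    then have "(\<Sum>i\<le>\<omega> 1. occ i \<omega> r) = (\<Sum>i\<in>{\<omega> r}. occ i \<omega> r)"
      by (intro sum.mono_neutral_right) (auto simp: occ_def)
    then show ?thesis by (simp add: occ_def)
  qed
  ultimately show ?thesis by (rule integrable_eq)
qed

lemma integral_left_lim:
  assumes "\<omega> \<in> Omega"
  shows "integral {0..t} (\<lambda>r. l r (left_lim \<omega> r)) = integral {0..t} (\<lambda>r. l r (\<omega> r))"
proof -
  obtain J where J: "finite J" "\<And>r. r \<notin> J \<Longrightarrow> left_lim \<omega> r = \<omega> r"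
    using Omega_left_lim[OF assms] by blast
  show ?thesis
    by (rule integral_spike[OF negligible_finite[OF J(1)]]) (use J(2) in auto)
qed

lemma compensated_level_diff:
  assumes "\<omega> \<in> Omega" "0 \<le> a" "a \<le> b" "b \<le> 1"
  shows "compensated_level i \<omega> b - compensated_level i \<omega> a =
    of_bool (i < \<omega> b) - of_bool (i < \<omega> a) - integral {a..b} (occ i \<omega>)"
  using Henstock_Kurzweil_Integration.integral_combine[where a=0 and c=a and b=b and f="occ i \<omega>"] occ_integrable[OF assms(1), of 0 b i] assms
  by (simp add: compensated_level_def)

lemma compensated_diff:
  assumes "\<omega> \<in> Omega" "0 \<le> a" "a \<le> b" "b \<le> 1"
  shows "compensated \<omega> b - compensated \<omega> a =
    real (\<omega> b) - real (\<omega> a) - integral {a..b} (\<lambda>r. l r (\<omega> r))"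
  using Henstock_Kurzweil_Integration.integral_combine[where a=0 and c=a and b=b and f="\<lambda>r. l r (\<omega> r)"] path_integrable[OF assms(1), of 0 b] assms
  by (simp add: compensated_def)

text \<open>Compares a cell of the stochastic integral with its left-point approximation. Without a
  jump the two agree; with one jump they differ by an integral over part of the cell. The factor
  \<open>real (\<omega> b) - real (\<omega> a)\<close> makes the errors of all cells add up to the
  mesh times the number of jumps.\<close>

lemma compensated_cell:
  assumes \<omega>: "\<omega> \<in> Omega" and ab: "0 \<le> a" "a \<le> b" "b \<le> 1" and unit: "\<omega> b \<le> \<omega> a + 1"
    and L: "\<And>r x. r \<in> {0..1} \<Longrightarrow> x \<le> i + 1 \<Longrightarrow> l r x \<le> L"
  shows "\<bar>compensated_level i \<omega> b - compensated_level i \<omega> a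
      - of_bool (\<omega> a = i) * (compensated \<omega> b - compensated \<omega> a)\<bar>
    \<le> L * (b - a) * (real (\<omega> b) - real (\<omega> a))"
proof -
  have range: "\<omega> a \<le> \<omega> r \<and> \<omega> r \<le> \<omega> b" if "r \<in> {a..b}" for r
    using Omega_mono[OF \<omega>] that by auto
  note int = occ_integrable[OF \<omega> ab(1,3), of i] path_integrable[OF \<omega> ab(1,3)]
  note diffs = compensated_level_diff[OF \<omega> ab] compensated_diff[OF \<omega> ab]
  consider "\<omega> b = \<omega> a" | "\<omega> b = \<omega> a + 1" "\<omega> a = i" | "\<omega> b = \<omega> a + 1" "\<omega> a \<noteq> i"
    using Omega_mono[OF \<omega> ab(2)] unit by linarith
  then show ?thesis
  proof cases
    case 1
    then have const: "\<omega> r = \<omega> a" if "r \<in> {a..b}" for r using range[OF that] by auto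
    have "integral {a..b} (occ i \<omega>) = of_bool (\<omega> a = i) * integral {a..b} (\<lambda>r. l r (\<omega> r))"
    proof (cases "\<omega> a = i")
      case True
      have "occ i \<omega> r = l r (\<omega> r)" if "r \<in> {a..b}" for r
        using const[OF that] True by (simp add: occ_def)
      then have "integral {a..b} (occ i \<omega>) = integral {a..b} (\<lambda>r. l r (\<omega> r))"
        by (rule integral_cong)
      then show ?thesis using True by simp
    next
      case False
      then have "occ i \<omega> r = 0" if "r \<in> {a..b}" for r
        using const[OF that] by (simp add: occ_def)
      then have "integral {a..b} (occ i \<omega>) = integral {a..b} (\<lambda>_. 0)"
        by (rule integral_cong)
      then show ?thesis using False by simp
    qed
    then show ?thesis unfolding diffs using 1 by simp
  next
    case 2
    \<comment> \<open>The contributions of the jump cancel. What remains is the intensity at level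
      \<open>i + 1\<close> over the time after the jump, which is why \<open>L\<close> must bound
      that level too.\<close>
    have "0 \<le> integral {a..b} (\<lambda>r. l r (\<omega> r) - occ i \<omega> r) \<and>
        integral {a..b} (\<lambda>r. l r (\<omega> r) - occ i \<omega> r) \<le> L * (b - a)"
    proof (intro integral_le_bound integrable_diff int ab)
      fix r assume r: "r \<in> {a..b}"
      then have "\<omega> r \<le> i + 1" "r \<in> {0..1}" using range[OF r] 2 ab by auto
      then show "0 \<le> l r (\<omega> r) - occ i \<omega> r \<and> l r (\<omega> r) - occ i \<omega> r \<le> L"
        using L[of r "\<omega> r"] L[of r i] l_pos[of r "\<omega> r"] l_pos[of r i] by (auto simp: occ_def)
    qed
    then show ?thesis unfolding diffs using 2 by (simp add: integral_diff int)
  next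
    case 3
    \<comment> \<open>The left-point term vanishes and the jump does not cross \<open>i\<close>; the
      only error is time spent at \<open>i\<close> in case the jump lands there.\<close>
    have "0 \<le> integral {a..b} (occ i \<omega>) \<and> integral {a..b} (occ i \<omega>) \<le> L * (b - a)"
    proof (intro integral_le_bound int ab)
      fix r assume r: "r \<in> {a..b}"
      then have "r \<in> {0..1}" using ab by auto
      then show "0 \<le> occ i \<omega> r \<and> occ i \<omega> r \<le> L"
        using L[of r i] l_pos[of r i] by (auto simp: occ_def)
    qed
    moreover have "(i < \<omega> b) = (i < \<omega> a)" using 3 by auto
    ultimately show ?thesis unfolding diffs using 3 by simp
  qed
qed

end

subsection \<open>Discrete stochastic integrals along a path\<close>

definition grid :: "real \<Rightarrow> real \<Rightarrow> nat \<Rightarrow> nat \<Rightarrow> real" where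
  "grid s t m k = s + (t - s) * real k / real m"

lemma grid_0 [simp]: "grid s t m 0 = s"
  by (simp add: grid_def)

lemma grid_end: "m > 0 \<Longrightarrow> grid s t m m = t"
  by (simp add: grid_def)

lemma grid_step: "grid s t m (Suc k) - grid s t m k = (t - s) / real m"
  by (simp add: grid_def add_divide_distrib distrib_left)

lemma grid_mono: "s \<le> t \<Longrightarrow> j \<le> k \<Longrightarrow> grid s t m j \<le> grid s t m k"
  by (auto simp: grid_def intro!: divide_right_mono mult_left_mono)

lemma grid_in:
  assumes "0 \<le> s" "s \<le> t" "t \<le> 1" "k \<le> m" "m > 0"
  shows "grid s t m k \<in> {0..1}"
  using grid_mono[OF assms(2), of 0 k m] grid_mono[OF assms(2,4), of m] grid_end[OF assms(5), of s t] assms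
  by simp

context jump_intensity
begin

text \<open>A left-point stochastic integral of \<open>of_bool (X = i)\<close> against the compensated process stopped
  at \<open>T\<close>. When the path overshoots the level \<open>i + 1\<close> within a cell, the value at the
  end of the cell is replaced by the terminal value; by the martingale property this does not change
  expectations, and it makes the sums dominated uniformly in the mesh.\<close>

definition level_sum :: "nat \<Rightarrow> real \<Rightarrow> real \<Rightarrow> real \<Rightarrow> nat \<Rightarrow> path \<Rightarrow> real" where
  "level_sum i T s t m \<omega> = (\<Sum>k<m. of_bool (\<omega> (grid s t m k) = i) *
     ((if \<omega> (grid s t m (Suc k)) \<le> i + 1 then compensated \<omega> (min (grid s t m (Suc k)) T)
       else compensated \<omega> (min 1 T)) - compensated \<omega> (min (grid s t m k) T)))"

text \<open>For a fixed path a fine grid has no overshooting cell, so the replacement of the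
  endpoint is inactive and \<open>compensated_cell\<close> applies to every cell. The total error is
  a constant depending on the path, divided by \<open>m\<close>.\<close>

lemma level_sum_tendsto:
  assumes \<omega>: "\<omega> \<in> Omega" and st: "0 \<le> s" "s \<le> t" "t \<le> 1" and T: "T \<in> {0..1}"
  shows "(\<lambda>m. level_sum i T s t m \<omega>) \<longlonglongrightarrow>
    compensated_level i \<omega> (min t T) - compensated_level i \<omega> (min s T)"
proof -
  obtain d where d: "d > 0" "\<And>a b. a \<le> b \<Longrightarrow> b - a < d \<Longrightarrow> \<omega> b \<le> \<omega> a + 1"
    using Omega_unit_jumps[OF \<omega>] by blast
  obtain L where L: "L > 0" "\<And>r x. r \<in> {0..1} \<Longrightarrow> x \<le> i + 1 \<Longrightarrow> l r x \<le> L"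
    using bound_up_to[of "i + 1"] by blast
  let ?V = "compensated_level i \<omega>" and ?M = "compensated \<omega>"
  define C where "C = L * (real (\<omega> 1) - real (\<omega> 0))"
  have bound: "\<bar>level_sum i T s t m \<omega> - (?V (min t T) - ?V (min s T))\<bar> \<le> C * (1 / real m)"
    if m: "m > 0" "1 / real m < d" for m
  proof -
    define a where "a k = min (grid s t m k) T" for k
    have step: "(t - s) / real m \<le> 1 / real m"
      using st by (intro divide_right_mono) auto
    have ga: "0 \<le> a k" "a k \<le> a (Suc k)" "a (Suc k) \<le> 1" "a (Suc k) - a k \<le> 1 / real m" if "k < m" for k
      using grid_in[OF st, of k m] grid_in[OF st, of "Suc k" m] grid_mono[OF st(2), of k "Suc k" m]
        that m T grid_step[of s t m k] step
      by (auto simp: a_def)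
    have jump: "\<omega> (grid s t m (Suc k)) \<le> \<omega> (grid s t m k) + 1" for k
      using d(2)[of "grid s t m k" "grid s t m (Suc k)"] grid_mono[OF st(2), of k "Suc k" m]
        grid_step[of s t m k] step m by auto
    \<comment> \<open>Beyond \<open>T\<close> both arguments of the increment equal
      \<open>T\<close>, so it does not matter at which time the indicator is read.\<close>
    have "level_sum i T s t m \<omega> = (\<Sum>k<m. of_bool (\<omega> (a k) = i) * (?M (a (Suc k)) - ?M (a k)))"
      unfolding level_sum_def
    proof (rule sum.cong)
      fix k assume "k \<in> {..<m}"
      show "of_bool (\<omega> (grid s t m k) = i) *
         ((if \<omega> (grid s t m (Suc k)) \<le> i + 1 then ?M (min (grid s t m (Suc k)) T)
           else ?M (min 1 T)) - ?M (min (grid s t m k) T)) =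
         of_bool (\<omega> (a k) = i) * (?M (a (Suc k)) - ?M (a k))"
      proof (cases "grid s t m k \<le> T")
        case True
        then show ?thesis using jump[of k] by (auto simp: a_def)
      next
        case False
        then have "a k = T" "a (Suc k) = T"
          using grid_mono[OF st(2), of k "Suc k" m] by (auto simp: a_def)
        then show ?thesis using jump[of k] by (auto simp: a_def)
      qed
    qed auto
    moreover have "?V (min t T) - ?V (min s T) = (\<Sum>k<m. ?V (a (Suc k)) - ?V (a k))"
      using sum_lessThan_telescope[of "\<lambda>k. ?V (a k)" m] grid_end[OF m(1), of s t] by (simp add: a_def)
    ultimately have "\<bar>level_sum i T s t m \<omega> - (?V (min t T) - ?V (min s T))\<bar> =
      \<bar>\<Sum>k<m. ?V (a (Suc k)) - ?V (a k) - of_bool (\<omega> (a k) = i) * (?M (a (Suc k)) - ?M (a k))\<bar>"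
      by (simp only: sum_subtractf abs_minus_commute)
    also have "\<dots> \<le> (\<Sum>k<m. L * (1 / real m) * (real (\<omega> (a (Suc k))) - real (\<omega> (a k))))"
    proof (rule order_trans[OF sum_abs], rule sum_mono)
      fix k assume k: "k \<in> {..<m}"
      have unit: "\<omega> (a (Suc k)) \<le> \<omega> (a k) + 1"
        using d(2)[of "a k" "a (Suc k)"] ga[of k] k m by auto
      have "\<bar>?V (a (Suc k)) - ?V (a k) - of_bool (\<omega> (a k) = i) * (?M (a (Suc k)) - ?M (a k))\<bar>
        \<le> L * (a (Suc k) - a k) * (real (\<omega> (a (Suc k))) - real (\<omega> (a k)))"
        using ga[of k] k by (intro compensated_cell \<omega> unit L(2)) auto
      also have "\<dots> \<le> L * (1 / real m) * (real (\<omega> (a (Suc k))) - real (\<omega> (a k)))"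
        using ga[of k] k L(1) Omega_mono[OF \<omega> ga(2)[of k]]
        by (intro mult_right_mono mult_left_mono) auto
      finally show "\<bar>?V (a (Suc k)) - ?V (a k) - of_bool (\<omega> (a k) = i) * (?M (a (Suc k)) - ?M (a k))\<bar>
        \<le> L * (1 / real m) * (real (\<omega> (a (Suc k))) - real (\<omega> (a k)))" .
    qed
    also have "\<dots> = L * (1 / real m) * (real (\<omega> (a m)) - real (\<omega> (a 0)))"
      by (simp only: sum_distrib_left[symmetric] sum_lessThan_telescope[of "\<lambda>k. real (\<omega> (a k))" m])
    also have "\<dots> \<le> L * (1 / real m) * (real (\<omega> 1) - real (\<omega> 0))"
    proof -
      have "\<omega> (a m) \<le> \<omega> 1" "\<omega> 0 \<le> \<omega> (a 0)"
        using st T by (auto intro!: Omega_mono[OF \<omega>] simp: a_def)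
      then show ?thesis using L(1) by (intro mult_left_mono) auto
    qed
    finally show ?thesis by (simp add: C_def mult_ac)
  qed
  have lim0: "(\<lambda>m. 1 / real m) \<longlonglongrightarrow> 0" by (rule lim_1_over_n)
  have "eventually (\<lambda>m. 1 / real m < d) sequentially"
    using lim0 d(1) by (rule order_tendstoD)
  then have "eventually (\<lambda>m. norm (level_sum i T s t m \<omega> - (?V (min t T) - ?V (min s T))) \<le> C * (1 / real m)) sequentially"
    using eventually_gt_at_top[of 0] by eventually_elim (use bound in auto)
  moreover have "(\<lambda>m. C * (1 / real m)) \<longlonglongrightarrow> 0"
    using tendsto_mult_right_zero[OF lim0] .
  ultimately have "(\<lambda>m. level_sum i T s t m \<omega> - (?V (min t T) - ?V (min s T))) \<longlonglongrightarrow> 0"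
    by (rule Lim_null_comparison)
  then show ?thesis by (rule LIM_zero_cancel)
qed

lemma compensated_increment_bound:
  assumes \<omega>: "\<omega> \<in> Omega" and ab: "0 \<le> a" "a \<le> b" "b \<le> 1" and k: "\<omega> b \<le> k"
    and L: "\<And>r x. r \<in> {0..1} \<Longrightarrow> x \<le> k \<Longrightarrow> l r x \<le> L"
  shows "\<bar>compensated \<omega> b - compensated \<omega> a\<bar> \<le> real (\<omega> b) - real (\<omega> a) + L * (b - a)"
proof -
  have "0 \<le> integral {a..b} (\<lambda>r. l r (\<omega> r)) \<and> integral {a..b} (\<lambda>r. l r (\<omega> r)) \<le> L * (b - a)"
  proof (intro integral_le_bound path_integrable \<omega> ab)
    fix r assume r: "r \<in> {a..b}"
    then have "\<omega> r \<le> k" "r \<in> {0..1}" using Omega_mono[OF \<omega>, of r b] ab k by auto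
    then show "0 \<le> l r (\<omega> r) \<and> l r (\<omega> r) \<le> L"
      using L[of r "\<omega> r"] l_pos[of r "\<omega> r"] by auto
  qed
  moreover have "\<omega> a \<le> \<omega> b" using Omega_mono[OF \<omega>] ab by auto
  ultimately show ?thesis unfolding compensated_diff[OF \<omega> ab] by auto
qed

text \<open>The bound does not depend on \<open>m\<close>; it is the dominating function for the
  limit of vanishing mesh, integrable because the stopped martingale is.\<close>

lemma level_sum_bound:
  assumes \<omega>: "\<omega> \<in> Omega" and st: "0 \<le> s" "s \<le> t" "t \<le> 1" and T: "T \<in> {0..1}" and m: "m > 0"
    and L: "L > 0" "\<And>r x. r \<in> {0..1} \<Longrightarrow> x \<le> i + 1 \<Longrightarrow> l r x \<le> L"
  shows "\<bar>level_sum i T s t m \<omega>\<bar> \<le> 2 * (real i + 1 + L) + \<bar>compensated \<omega> (min 1 T)\<bar>"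
proof -
  let ?M = "compensated \<omega>"
  define a where "a k = min (grid s t m k) T" for k
  \<comment> \<open>Cells ending at or below \<open>i + 1\<close> are charged to the growth of
    \<open>U\<close>, which totals at most \<open>i + 1 + L\<close>. The overshooting cell is
    charged to \<open>R\<close>, which steps from 0 to 1 at most once; \<open>K\<close> bounds the
    one increment that occurs there.\<close>
  define U where "U x = min (real (\<omega> x)) (real i + 1) + L * x" for x
  define R where "R k = (of_bool (i + 1 < \<omega> (grid s t m k)) :: real)" for k
  define K where "K = \<bar>?M (min 1 T)\<bar> + real i + L"
  have ga: "0 \<le> a k" "a k \<le> a (Suc k)" "a (Suc k) \<le> 1" if "k < m" for k
    using grid_in[OF st, of k m] grid_in[OF st, of "Suc k" m] grid_mono[OF st(2), of k "Suc k" m] that m T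
    by (auto simp: a_def)
  have U_mono: "U x \<le> U y" if "x \<le> y" for x y
    using Omega_mono[OF \<omega> that] that L(1) by (auto simp: U_def intro!: add_mono mult_left_mono)
  have "\<bar>level_sum i T s t m \<omega>\<bar> \<le> (\<Sum>k<m. (U (a (Suc k)) - U (a k)) + K * (R (Suc k) - R k))"
    unfolding level_sum_def
  proof (rule order_trans[OF sum_abs], rule sum_mono)
    fix k assume "k \<in> {..<m}"
    then have k: "k < m" by simp
    let ?x = "grid s t m k" and ?y = "grid s t m (Suc k)"
    have xy: "?x \<le> ?y" using grid_mono[OF st(2)] by simp
    have R0: "0 \<le> R (Suc k) - R k" using Omega_mono[OF \<omega> xy] by (simp add: R_def)
    have K0: "0 \<le> K" using L(1) by (simp add: K_def)
    have U0: "0 \<le> U (a (Suc k)) - U (a k)" using U_mono ga[OF k] by simp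
    show "\<bar>of_bool (\<omega> ?x = i) * ((if \<omega> ?y \<le> i + 1 then ?M (min ?y T) else ?M (min 1 T)) - ?M (min ?x T))\<bar>
      \<le> (U (a (Suc k)) - U (a k)) + K * (R (Suc k) - R k)"
    proof (cases "\<omega> ?x = i")
      case False
      then show ?thesis using R0 K0 U0 by simp
    next
      case x: True
      show ?thesis
      proof (cases "\<omega> ?y \<le> i + 1")
        case y: True
        have le: "\<omega> (a (Suc k)) \<le> i + 1" "\<omega> (a k) \<le> i + 1"
          using Omega_mono[OF \<omega>, of "a (Suc k)" ?y] Omega_mono[OF \<omega>, of "a k" "a (Suc k)"] ga[OF k] y
          by (auto simp: a_def)
        have "\<bar>?M (a (Suc k)) - ?M (a k)\<bar> \<le> real (\<omega> (a (Suc k))) - real (\<omega> (a k)) + L * (a (Suc k) - a k)"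
          using ga[OF k] le by (intro compensated_increment_bound[where k = "i + 1"] \<omega> L(2)) auto
        also have "\<dots> = U (a (Suc k)) - U (a k)"
          using le by (auto simp: U_def min_def algebra_simps)
        finally show ?thesis using x y R0 K0 by (simp add: a_def add_increasing2)
      next
        case y: False
        have "\<bar>?M (a k) - ?M 0\<bar> \<le> real (\<omega> (a k)) - real (\<omega> 0) + L * (a k - 0)"
          using ga[OF k] Omega_mono[OF \<omega>, of "a k" ?x] x
          by (intro compensated_increment_bound[where k = "i + 1"] \<omega> L(2)) (auto simp: a_def)
        also have "\<dots> \<le> real i + L"
        proof -
          have "\<omega> (a k) \<le> i" using Omega_mono[OF \<omega>, of "a k" ?x] x by (auto simp: a_def)
          moreover have "L * a k \<le> L * 1" using ga[OF k] L(1) by (intro mult_left_mono) auto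
          ultimately show ?thesis by auto
        qed
        finally have "\<bar>?M (a k)\<bar> \<le> real i + L" by (simp add: compensated_def)
        moreover have "R (Suc k) - R k = 1" using x y by (simp add: R_def)
        moreover have "\<bar>?M (min 1 T) - ?M (a k)\<bar> \<le> \<bar>?M (min 1 T)\<bar> + \<bar>?M (a k)\<bar>"
          by (rule abs_triangle_ineq4)
        ultimately have "\<bar>?M (min 1 T) - ?M (a k)\<bar> \<le> (U (a (Suc k)) - U (a k)) + K * (R (Suc k) - R k)"
          using U0 by (simp add: K_def)
        then show ?thesis using x y by (simp add: a_def)
      qed
    qed
  qed
  also have "\<dots> = (U (a m) - U (a 0)) + K * (R m - R 0)"
    by (simp only: sum.distrib sum_distrib_left[symmetric] sum_lessThan_telescope[of "\<lambda>k. U (a k)" m]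
        sum_lessThan_telescope[of R m])
  also have "\<dots> \<le> (real i + 1 + L) + K * 1"
  proof (rule add_mono)
    have "a m \<le> 1" "0 \<le> a 0" using st T by (auto simp: a_def)
    then have "L * a m \<le> L * 1" "0 \<le> L * a 0" using L(1) by (auto intro!: mult_left_mono)
    then show "U (a m) - U (a 0) \<le> real i + 1 + L" by (auto simp: U_def)
    show "K * (R m - R 0) \<le> K * 1"
      using L(1) by (intro mult_left_mono) (auto simp: K_def R_def)
  qed
  finally show ?thesis by (simp add: K_def)
qed

end

subsection \<open>Expected occupation times\<close>

interpretation Fsig: sigma_algebra Omega "Fsig u" for u
  unfolding Fsig_def by (rule sigma_algebra_sigma_sets) (auto simp: Fgen_def)

lemma Fsig_mono: "s \<le> t \<Longrightarrow> Fsig s \<subseteq> Fsig t"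
  unfolding Fsig_def by (rule sigma_sets_mono') (force simp: Fgen_def)

lemma Fsig_level:
  assumes "0 \<le> t" "t \<le> u"
  shows "{\<omega>\<in>Omega. Q (\<omega> t)} \<in> Fsig u"
proof -
  have "{\<omega>\<in>Omega. \<omega> t = k} \<in> Fsig u" for k
    unfolding Fsig_def using assms by (intro sigma_sets.Basic) (auto simp: Fgen_def)
  then have "(\<Union>k\<in>{k. Q k}. {\<omega>\<in>Omega. \<omega> t = k}) \<in> Fsig u"
    by (intro Fsig.countable_UN'') auto
  also have "(\<Union>k\<in>{k. Q k}. {\<omega>\<in>Omega. \<omega> t = k}) = {\<omega>\<in>Omega. Q (\<omega> t)}" by auto
  finally show ?thesis .
qed

locale markov_counting = jump_intensity l for l +
  fixes P :: "path measure"
  assumes counting: "counting_process P l"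
begin

sublocale prob_space P
  using counting by (simp add: counting_process_def)

lemma space_P [simp]: "space P = Omega"
  and sets_P: "sets P = Fsig 1"
  using counting by (simp_all add: counting_process_def)

lemma Fsig_sets: "u \<le> 1 \<Longrightarrow> A \<in> Fsig u \<Longrightarrow> A \<in> sets P"
  using Fsig_mono[of u 1] by (auto simp: sets_P)

lemma level_sets: "t \<in> {0..1} \<Longrightarrow> {\<omega>\<in>Omega. Q (\<omega> t)} \<in> sets P"
  using Fsig_level[of t 1 Q] by (auto simp: sets_P)

text \<open>Restates the local martingale property for \<open>compensated\<close>. Since the
  stopping times increase and stay below 1, reaching 1 once means staying there, hence the eventual
  form.\<close>

lemma localizing_sequence:
  obtains \<tau> :: "nat \<Rightarrow> path \<Rightarrow> real" where
    "\<And>n \<omega>. \<omega> \<in> Omega \<Longrightarrow> \<tau> n \<omega> \<in> {0..1}"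
    "AE \<omega> in P. eventually (\<lambda>n. \<tau> n \<omega> = 1) sequentially"
    "\<And>n t. t \<in> {0..1} \<Longrightarrow> integrable P (\<lambda>\<omega>. compensated \<omega> (min t (\<tau> n \<omega>)))"
    "\<And>n s t A. 0 \<le> s \<Longrightarrow> s \<le> t \<Longrightarrow> t \<le> 1 \<Longrightarrow> A \<in> Fsig s \<Longrightarrow>
      (\<integral>\<omega>. indicator A \<omega> * compensated \<omega> (min t (\<tau> n \<omega>)) \<partial>P) =
      (\<integral>\<omega>. indicator A \<omega> * compensated \<omega> (min s (\<tau> n \<omega>)) \<partial>P)"
proof -
  let ?M = "\<lambda>\<omega> t. real (\<omega> t) - real (\<omega> 0) - integral {0..t} (\<lambda>r. l r (left_lim \<omega> r))"
  obtain \<tau> :: "nat \<Rightarrow> path \<Rightarrow> real" where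
    \<tau>: "\<And>n. stopping_time01 (\<tau> n)" and
    inc: "\<And>\<omega> n. \<omega> \<in> Omega \<Longrightarrow> \<tau> n \<omega> \<le> \<tau> (Suc n) \<omega>" and
    ae: "AE \<omega> in P. \<exists>n. \<tau> n \<omega> = 1" and
    mart: "\<And>n. martingale01 P (\<lambda>\<omega> t. ?M \<omega> (min t (\<tau> n \<omega>)))"
    using counting unfolding counting_process_def local_martingale01_def by blast
  have M: "?M \<omega> t = compensated \<omega> t" if "\<omega> \<in> Omega" for \<omega> t
    using integral_left_lim[OF that] by (simp add: compensated_def)
  show ?thesis
  proof (rule that)
    show \<tau>01: "\<tau> n \<omega> \<in> {0..1}" if "\<omega> \<in> Omega" for n \<omega>
      using \<tau>[of n] that by (auto simp: stopping_time01_def)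
    have "AE \<omega> in P. \<omega> \<in> Omega" using AE_space[of P] by simp
    with ae show "AE \<omega> in P. eventually (\<lambda>n. \<tau> n \<omega> = 1) sequentially"
    proof eventually_elim
      case (elim \<omega>)
      then obtain n where n: "\<tau> n \<omega> = 1" by auto
      have "\<tau> m \<omega> = 1" if "m \<ge> n" for m
        using lift_Suc_mono_le[of "\<lambda>n. \<tau> n \<omega>", OF inc that] elim \<tau>01[of \<omega> m] n by fastforce
      then show ?case by (auto simp: eventually_sequentially)
    qed
    show "integrable P (\<lambda>\<omega>. compensated \<omega> (min t (\<tau> n \<omega>)))" if "t \<in> {0..1}" for n t
    proof -
      have "integrable P (\<lambda>\<omega>. ?M \<omega> (min t (\<tau> n \<omega>)))"
        using mart[of n] that by (simp add: martingale01_def)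
      then show ?thesis
        by (rule Bochner_Integration.integrable_cong[THEN iffD1, rotated -1]) (auto simp only: M space_P)
    qed
    show "(\<integral>\<omega>. indicator A \<omega> * compensated \<omega> (min t (\<tau> n \<omega>)) \<partial>P) =
      (\<integral>\<omega>. indicator A \<omega> * compensated \<omega> (min s (\<tau> n \<omega>)) \<partial>P)"
      if "0 \<le> s" "s \<le> t" "t \<le> 1" "A \<in> Fsig s" for n s t A
    proof -
      have "(\<integral>\<omega>. indicator A \<omega> * ?M \<omega> (min t (\<tau> n \<omega>)) \<partial>P) =
        (\<integral>\<omega>. indicator A \<omega> * ?M \<omega> (min s (\<tau> n \<omega>)) \<partial>P)"
        using mart[of n] that unfolding martingale01_def by blast
      moreover have "(\<integral>\<omega>. indicator A \<omega> * ?M \<omega> (min u (\<tau> n \<omega>)) \<partial>P) =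
        (\<integral>\<omega>. indicator A \<omega> * compensated \<omega> (min u (\<tau> n \<omega>)) \<partial>P)" for u
        by (intro Bochner_Integration.integral_cong) (auto simp only: M space_P)
      ultimately show ?thesis by simp
    qed
  qed
qed

text \<open>Joint measurability in time and path is what allows Fubini for expected occupation
  times.\<close>

lemma joint_level_measurable:
  "{(r, \<omega>). r \<in> {0..1} \<and> \<omega> \<in> Omega \<and> \<omega> r = i} \<in> sets (lborel \<Otimes>\<^sub>M P)"
proof -
  have le: "{(r, \<omega>). r \<in> {0..1} \<and> \<omega> \<in> Omega \<and> \<omega> r \<le> i} \<in> sets (lborel \<Otimes>\<^sub>M P)" for i
  proof -
    \<comment> \<open>By monotonicity and right continuity, \<open>\<omega> r \<le> i\<close> iff \<open>\<omega> q \<le> i\<close> for some rational \<open>q > r\<close>;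
      the endpoint \<open>r = 1\<close> is covered by replacing \<open>q\<close> by \<open>min q 1\<close>.\<close>
    have "{(r, \<omega>). r \<in> {0..1} \<and> \<omega> \<in> Omega \<and> \<omega> r \<le> i} =
      (\<Union>q\<in>{0<..} \<inter> \<rat>. ({0..1} \<inter> {..<q}) \<times> {\<omega>\<in>Omega. \<omega> (min q 1) \<le> i})" (is "?L = ?R")
    proof (intro equalityI subsetI)
      fix p assume "p \<in> ?L"
      then obtain r \<omega> where p: "p = (r, \<omega>)" "r \<in> {0..1}" "\<omega> \<in> Omega" "\<omega> r \<le> i" by auto
      obtain b where b: "b > r" "\<And>s. r < s \<Longrightarrow> s < b \<Longrightarrow> \<omega> s = \<omega> r"
        using Omega_right_constant[OF p(3), of r] by (auto simp: eventually_at_right_field)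
      obtain q where q: "q \<in> \<rat>" "r < q" "q < b" using Rats_dense_in_real[OF b(1)] by auto
      have "\<omega> (min q 1) \<le> \<omega> q" by (intro Omega_mono p(3)) auto
      then show "p \<in> ?R" using p q b(2)[of q] by auto
    next
      fix p assume "p \<in> ?R"
      then obtain r \<omega> q where p: "p = (r, \<omega>)" "r \<in> {0..1}" "r < q" "\<omega> \<in> Omega" "\<omega> (min q 1) \<le> i" by auto
      have "\<omega> r \<le> \<omega> (min q 1)" using p by (intro Omega_mono) auto
      then show "p \<in> ?L" using p by auto
    qed
    also have "\<dots> \<in> sets (lborel \<Otimes>\<^sub>M P)"
      by (intro sets.countable_UN'' pair_measureI level_sets countable_Int2 countable_rat) auto
    finally show ?thesis .
  qed
  show ?thesis
  proof (cases i)
    case 0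
    then show ?thesis using le[of 0] by simp
  next
    case (Suc j)
    have "{(r, \<omega>). r \<in> {0..1} \<and> \<omega> \<in> Omega \<and> \<omega> r = i} =
      {(r, \<omega>). r \<in> {0..1} \<and> \<omega> \<in> Omega \<and> \<omega> r \<le> i} - {(r, \<omega>). r \<in> {0..1} \<and> \<omega> \<in> Omega \<and> \<omega> r \<le> j}"
      using Suc by auto
    then show ?thesis using sets.Diff[OF le[of i] le[of j]] by simp
  qed
qed

text \<open>Fubini on the product of time and path space: the expected time integral of
  \<open>occ\<close> on \<open>A\<close> is the time integral of the intensity against the level
  probabilities.\<close>

lemma expected_occ:
  assumes A: "A \<in> sets P" and st: "0 \<le> s" "t \<le> 1"
  shows occ_integral_measurable: "(\<lambda>\<omega>. integral {s..t} (occ i \<omega>)) \<in> borel_measurable P"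
    and occ_prob_integrable: "(\<lambda>r. l r i * measure P (A \<inter> {\<omega>\<in>Omega. \<omega> r = i})) integrable_on {s..t}"
    and expectation_occ: "(\<integral>\<omega>. indicator A \<omega> * integral {s..t} (occ i \<omega>) \<partial>P) =
      integral {s..t} (\<lambda>r. l r i * measure P (A \<inter> {\<omega>\<in>Omega. \<omega> r = i}))"
proof -
  let ?E = "{(r, \<omega>). r \<in> {0..1} \<and> \<omega> \<in> Omega \<and> \<omega> r = i}"
  interpret pair_sigma_finite lborel P ..
  \<comment> \<open>A version of the integrand on the whole product space. The indicator of the unit
    interval is attached to \<open>l\<close>, whose measurability is known only there.\<close>
  define h where "h r \<omega> = indicator ?E (r, \<omega>) * (indicator {s..t} r * (indicator {0..1} r * l r i))" for r \<omega>
  have h_occ: "h r \<omega> = indicator {s..t} r *\<^sub>R occ i \<omega> r" if "\<omega> \<in> Omega" for r \<omega>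
    using that st by (auto simp: h_def occ_def indicator_def)
  obtain L where L: "L > 0" "\<And>r x. r \<in> {0..1} \<Longrightarrow> x \<le> i \<Longrightarrow> l r x \<le> L"
    using bound_up_to[of i] by blast
  have meas_l [measurable]: "(\<lambda>r. indicator {0..1} r * l r i) \<in> borel_measurable lborel"
    using set_integrable_l[of i] by (rule borel_measurable_integrable)
  have E [measurable]: "?E \<in> sets (lborel \<Otimes>\<^sub>M P)" by (rule joint_level_measurable)
  have h_meas [measurable]: "case_prod h \<in> borel_measurable (lborel \<Otimes>\<^sub>M P)"
  proof -
    have "(\<lambda>x. indicator ?E x * (indicator {s..t} (fst x) * (indicator {0..1} (fst x) * l (fst x) i)))
      \<in> borel_measurable (lborel \<Otimes>\<^sub>M P)" by measurable
    then show ?thesis by (simp add: h_def case_prod_beta')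
  qed
  have bound: "\<bar>indicator A' \<omega> * h r \<omega>\<bar> \<le> L * indicator {0..1} r" for A' r \<omega>
    using L(2)[of r i] L(1) l_pos[of r i] by (auto simp: h_def indicator_def)
  have int: "integrable (lborel \<Otimes>\<^sub>M P) (\<lambda>(r, \<omega>). indicator A \<omega> * h r \<omega>)"
  proof (rule Bochner_Integration.integrable_bound)
    have "integrable (lborel \<Otimes>\<^sub>M P) (indicator ({0..1::real} \<times> space P) :: _ \<Rightarrow> real)"
    proof (rule integrable_real_indicator)
      show "{0..1::real} \<times> space P \<in> sets (lborel \<Otimes>\<^sub>M P)" by (intro pair_measureI sets.top) auto
      have "emeasure (lborel \<Otimes>\<^sub>M P) ({0..1::real} \<times> space P) = emeasure lborel {0..1::real} * emeasure P (space P)"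
        by (rule sigma_finite_measure.emeasure_pair_measure_Times)
          (auto intro: prob_space_imp_sigma_finite prob_space_axioms simp del: space_P)
      also have "\<dots> = 1" unfolding emeasure_space_1 by simp
      finally show "emeasure (lborel \<Otimes>\<^sub>M P) ({0..1::real} \<times> space P) < \<infinity>" by simp
    qed
    then show "integrable (lborel \<Otimes>\<^sub>M P) (\<lambda>x. L * indicator ({0..1::real} \<times> space P) x)" by simp
    show "(\<lambda>(r, \<omega>). indicator A \<omega> * h r \<omega>) \<in> borel_measurable (lborel \<Otimes>\<^sub>M P)"
      using A by measurable
    show "AE x in lborel \<Otimes>\<^sub>M P. norm (case x of (r, \<omega>) \<Rightarrow> indicator A \<omega> * h r \<omega>) \<le> norm (L * indicator ({0..1::real} \<times> space P) x)"
      using bound L(1) by (intro AE_I2) (auto simp: space_pair_measure indicator_times abs_mult)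
  qed
  have inner: "(\<integral>r. h r \<omega> \<partial>lborel) = integral {s..t} (occ i \<omega>)" if "\<omega> \<in> Omega" for \<omega>
  proof -
    have "(\<integral>r. h r \<omega> \<partial>lborel) = (LINT r:{s..t}|lborel. occ i \<omega> r)"
      unfolding set_lebesgue_integral_def using h_occ[OF that] by simp
    also have "\<dots> = integral {s..t} (occ i \<omega>)"
      by (rule set_borel_integral_eq_integral(2)[OF occ_set_integrable[OF that st]])
    finally show ?thesis .
  qed
  have outer: "(\<integral>\<omega>. indicator A \<omega> * h r \<omega> \<partial>P) =
    indicator {s..t} r *\<^sub>R (l r i * measure P (A \<inter> {\<omega>\<in>Omega. \<omega> r = i}))" for r
  proof (cases "r \<in> {s..t}")
    case True
    have "(\<integral>\<omega>. indicator A \<omega> * h r \<omega> \<partial>P) = (\<integral>\<omega>. l r i * indicator (A \<inter> {\<omega>\<in>Omega. \<omega> r = i}) \<omega> \<partial>P)"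
      using True st by (intro Bochner_Integration.integral_cong) (auto simp: h_def indicator_def)
    also have "\<dots> = l r i * measure P (A \<inter> {\<omega>\<in>Omega. \<omega> r = i})"
    proof -
      have "A \<inter> {\<omega>\<in>Omega. \<omega> r = i} \<inter> space P = A \<inter> {\<omega>\<in>Omega. \<omega> r = i}" by auto
      then show ?thesis by simp
    qed
    finally show ?thesis using True by simp
  qed (simp add: h_def)
  have "(\<lambda>\<omega>. \<integral>r. h r \<omega> \<partial>lborel) \<in> borel_measurable P" by measurable
  then show "(\<lambda>\<omega>. integral {s..t} (occ i \<omega>)) \<in> borel_measurable P"
    by (rule measurable_cong[THEN iffD1, rotated]) (simp add: inner)
  have "integrable lborel (\<lambda>r. \<integral>\<omega>. indicator A \<omega> * h r \<omega> \<partial>P)"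
    using integrable_fst'[OF int] by simp
  then have si: "set_integrable lborel {s..t} (\<lambda>r. l r i * measure P (A \<inter> {\<omega>\<in>Omega. \<omega> r = i}))"
    unfolding outer set_integrable_def .
  then show "(\<lambda>r. l r i * measure P (A \<inter> {\<omega>\<in>Omega. \<omega> r = i})) integrable_on {s..t}"
    by (rule set_borel_integral_eq_integral(1))
  have "(\<integral>\<omega>. indicator A \<omega> * integral {s..t} (occ i \<omega>) \<partial>P) = (\<integral>\<omega>. (\<integral>r. indicator A \<omega> * h r \<omega> \<partial>lborel) \<partial>P)"
    by (intro Bochner_Integration.integral_cong) (auto simp: inner)
  also have "\<dots> = (\<integral>r. (\<integral>\<omega>. indicator A \<omega> * h r \<omega> \<partial>P) \<partial>lborel)"
    by (rule Fubini_integral[OF int])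
  also have "\<dots> = (LINT r:{s..t}|lborel. l r i * measure P (A \<inter> {\<omega>\<in>Omega. \<omega> r = i}))"
    unfolding outer set_lebesgue_integral_def ..
  also have "\<dots> = integral {s..t} (\<lambda>r. l r i * measure P (A \<inter> {\<omega>\<in>Omega. \<omega> r = i}))"
    by (rule set_borel_integral_eq_integral(2)[OF si])
  finally show "(\<integral>\<omega>. indicator A \<omega> * integral {s..t} (occ i \<omega>) \<partial>P) =
      integral {s..t} (\<lambda>r. l r i * measure P (A \<inter> {\<omega>\<in>Omega. \<omega> r = i}))" .
qed

end

subsection \<open>The forward equation\<close>

context markov_counting
begin

text \<open>Each cell is a sum of two martingale increments on events known at their left endpoints:
  one over the cell, and one from the end of the cell to time 1 when the path has overshot.\<close>

lemma level_sum_expectation: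
  assumes \<tau>: "\<And>t. t \<in> {0..1} \<Longrightarrow> integrable P (\<lambda>\<omega>. compensated \<omega> (min t (\<tau> \<omega>)))"
    and mart: "\<And>s t A. 0 \<le> s \<Longrightarrow> s \<le> t \<Longrightarrow> t \<le> 1 \<Longrightarrow> A \<in> Fsig s \<Longrightarrow>
      (\<integral>\<omega>. indicator A \<omega> * compensated \<omega> (min t (\<tau> \<omega>)) \<partial>P) =
      (\<integral>\<omega>. indicator A \<omega> * compensated \<omega> (min s (\<tau> \<omega>)) \<partial>P)"
    and st: "0 \<le> s" "s \<le> t" "t \<le> 1" and m: "m > 0" and A: "A \<in> Fsig s"
  shows "integrable P (\<lambda>\<omega>. indicator A \<omega> * level_sum i (\<tau> \<omega>) s t m \<omega>)"
    and "(\<integral>\<omega>. indicator A \<omega> * level_sum i (\<tau> \<omega>) s t m \<omega> \<partial>P) = 0"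
proof -
  define M where "M t \<omega> = compensated \<omega> (min t (\<tau> \<omega>))" for t \<omega>
  define g where "g = grid s t m"
  \<comment> \<open>\<open>E k\<close> is decided at the start of the cell, \<open>B k\<close> (the
    overshoot) only at its end; this dictates the times between which the martingale property is
    used.\<close>
  define E where "E k = A \<inter> {\<omega>\<in>Omega. \<omega> (g k) = i}" for k
  define B where "B k = E k \<inter> {\<omega>\<in>Omega. i + 1 < \<omega> (g (Suc k))}" for k
  have g01: "g k \<in> {0..1}" if "k \<le> m" for k
    using grid_in[OF st that m] by (simp add: g_def)
  have gs: "s \<le> g k" "g k \<le> g (Suc k)" for k
    using grid_mono[OF st(2), of 0 k m] grid_mono[OF st(2), of k "Suc k" m] by (auto simp: g_def)
  have E: "E k \<in> Fsig (g k)" if "k \<le> m" for k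
    using A Fsig_mono[OF gs(1)[of k]] g01[OF that] unfolding E_def
    by (intro Fsig.Int Fsig_level) auto
  have B: "B k \<in> Fsig (g (Suc k))" if "k < m" for k
    using E[of k] Fsig_mono[OF gs(2)[of k]] g01[of "Suc k"] that unfolding B_def
    by (intro Fsig.Int Fsig_level) auto
  have int: "integrable P (\<lambda>\<omega>. indicator D \<omega> * M u \<omega>)" if "u \<in> {0..1}" "D \<in> sets P" for u D
    using integrable_mult_indicator[OF that(2) \<tau>[OF that(1)]] by (simp add: M_def)
  define f where "f k \<omega> = (indicator (E k) \<omega> * M (g (Suc k)) \<omega> - indicator (E k) \<omega> * M (g k) \<omega>) +
    (indicator (B k) \<omega> * M 1 \<omega> - indicator (B k) \<omega> * M (g (Suc k)) \<omega>)" for k \<omega>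
  have eq: "indicator A \<omega> * level_sum i (\<tau> \<omega>) s t m \<omega> = (\<Sum>k<m. f k \<omega>)" if "\<omega> \<in> space P" for \<omega>
    unfolding level_sum_def sum_distrib_left g_def[symmetric] M_def[symmetric]
    using that by (intro sum.cong) (auto simp: f_def E_def B_def indicator_def)
  have f: "integrable P (f k) \<and> (\<integral>\<omega>. f k \<omega> \<partial>P) = 0" if k: "k < m" for k
  proof -
    have sets: "E k \<in> sets P" "B k \<in> sets P"
      using E[of k] B[of k] Fsig_sets g01[of k] g01[of "Suc k"] k by auto
    have ints: "integrable P (\<lambda>\<omega>. indicator (E k) \<omega> * M (g (Suc k)) \<omega>)"
      "integrable P (\<lambda>\<omega>. indicator (E k) \<omega> * M (g k) \<omega>)"
      "integrable P (\<lambda>\<omega>. indicator (B k) \<omega> * M 1 \<omega>)"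
      "integrable P (\<lambda>\<omega>. indicator (B k) \<omega> * M (g (Suc k)) \<omega>)"
      using sets g01[of k] g01[of "Suc k"] k by (auto intro!: int)
    have "(\<integral>\<omega>. indicator (E k) \<omega> * M (g (Suc k)) \<omega> \<partial>P) = (\<integral>\<omega>. indicator (E k) \<omega> * M (g k) \<omega> \<partial>P)"
      "(\<integral>\<omega>. indicator (B k) \<omega> * M 1 \<omega> \<partial>P) = (\<integral>\<omega>. indicator (B k) \<omega> * M (g (Suc k)) \<omega> \<partial>P)"
      unfolding M_def using E[of k] B[of k] g01[of k] g01[of "Suc k"] gs[of k] k by (auto intro!: mart)
    then show ?thesis unfolding f_def using ints by simp
  qed
  have "integrable P (\<lambda>\<omega>. \<Sum>k<m. f k \<omega>)" using f by (intro Bochner_Integration.integrable_sum) auto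
  then show "integrable P (\<lambda>\<omega>. indicator A \<omega> * level_sum i (\<tau> \<omega>) s t m \<omega>)"
    by (rule Bochner_Integration.integrable_cong[THEN iffD1, rotated -1]) (auto simp only: eq)
  have "(\<integral>\<omega>. indicator A \<omega> * level_sum i (\<tau> \<omega>) s t m \<omega> \<partial>P) = (\<integral>\<omega>. (\<Sum>k<m. f k \<omega>) \<partial>P)"
    by (intro Bochner_Integration.integral_cong) (auto simp only: eq)
  also have "\<dots> = 0" using f by (subst Bochner_Integration.integral_sum) auto
  finally show "(\<integral>\<omega>. indicator A \<omega> * level_sum i (\<tau> \<omega>) s t m \<omega> \<partial>P) = 0" .
qed

text \<open>Two dominated limits, in this order: first the mesh tends to 0 with the stopping time
  fixed, dominated by \<open>level_sum_bound\<close>; then the localization is removed, where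
  \<open>compensated_level\<close> is itself bounded.\<close>

lemma compensated_level_expectation:
  assumes st: "0 \<le> s" "s \<le> t" "t \<le> 1" and A: "A \<in> Fsig s"
  shows "(\<integral>\<omega>. indicator A \<omega> * (compensated_level i \<omega> t - compensated_level i \<omega> s) \<partial>P) = 0"
proof -
  obtain \<tau> :: "nat \<Rightarrow> path \<Rightarrow> real" where
    \<tau>01: "\<And>n \<omega>. \<omega> \<in> Omega \<Longrightarrow> \<tau> n \<omega> \<in> {0..1}" and
    ae: "AE \<omega> in P. eventually (\<lambda>n. \<tau> n \<omega> = 1) sequentially" and
    int: "\<And>n t. t \<in> {0..1} \<Longrightarrow> integrable P (\<lambda>\<omega>. compensated \<omega> (min t (\<tau> n \<omega>)))" and
    mart: "\<And>n s t A. 0 \<le> s \<Longrightarrow> s \<le> t \<Longrightarrow> t \<le> 1 \<Longrightarrow> A \<in> Fsig s \<Longrightarrow>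
      (\<integral>\<omega>. indicator A \<omega> * compensated \<omega> (min t (\<tau> n \<omega>)) \<partial>P) =
      (\<integral>\<omega>. indicator A \<omega> * compensated \<omega> (min s (\<tau> n \<omega>)) \<partial>P)"
    using localizing_sequence by blast
  obtain L where L: "L > 0" "\<And>r x. r \<in> {0..1} \<Longrightarrow> x \<le> i + 1 \<Longrightarrow> l r x \<le> L"
    using bound_up_to[of "i + 1"] by blast
  have A_sets: "A \<in> sets P" using st by (intro Fsig_sets[OF _ A]) auto
  let ?V = "compensated_level i"
  let ?D = "\<lambda>n \<omega>. indicator A \<omega> * (?V \<omega> (min t (\<tau> n \<omega>)) - ?V \<omega> (min s (\<tau> n \<omega>)))"
  have step: "?D n \<in> borel_measurable P \<and> (\<integral>\<omega>. ?D n \<omega> \<partial>P) = 0" for n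
  proof -
    note ls = level_sum_expectation[where \<tau> = "\<tau> n", OF int mart st _ A]
    \<comment> \<open>The index is shifted since a grid needs at least one cell.\<close>
    let ?S = "\<lambda>m \<omega>. indicator A \<omega> * level_sum i (\<tau> n \<omega>) s t (Suc m) \<omega>"
    have lim: "(\<lambda>m. ?S m \<omega>) \<longlonglongrightarrow> ?D n \<omega>" if "\<omega> \<in> space P" for \<omega>
    proof -
      have "\<omega> \<in> Omega" using that by simp
      from LIMSEQ_Suc[OF level_sum_tendsto[OF this st \<tau>01[OF this]]] show ?thesis
        by (rule tendsto_mult[OF tendsto_const])
    qed
    have meas: "?S m \<in> borel_measurable P" for m
      using ls(1)[of "Suc m"] by (intro borel_measurable_integrable) auto
    have D_meas: "?D n \<in> borel_measurable P"
      by (rule borel_measurable_LIMSEQ_real[OF lim meas])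
    have "(\<lambda>m. \<integral>\<omega>. ?S m \<omega> \<partial>P) \<longlonglongrightarrow> (\<integral>\<omega>. ?D n \<omega> \<partial>P)"
    proof (rule integral_dominated_convergence)
      show "integrable P (\<lambda>\<omega>. 2 * (real i + 1 + L) + \<bar>compensated \<omega> (min 1 (\<tau> n \<omega>))\<bar>)"
        using int[of 1 n] by (intro Bochner_Integration.integrable_add integrable_abs) auto
      show "AE \<omega> in P. (\<lambda>m. ?S m \<omega>) \<longlonglongrightarrow> ?D n \<omega>" using lim by (rule AE_I2)
      show "AE \<omega> in P. norm (?S m \<omega>) \<le> 2 * (real i + 1 + L) + \<bar>compensated \<omega> (min 1 (\<tau> n \<omega>))\<bar>" for m
      proof (rule AE_I2)
        fix \<omega> assume "\<omega> \<in> space P"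
        then have "\<omega> \<in> Omega" by simp
        from level_sum_bound[OF this st \<tau>01[OF this, of n], where m = "Suc m" and i = i and L = L] L
        have "\<bar>level_sum i (\<tau> n \<omega>) s t (Suc m) \<omega>\<bar> \<le> 2 * (real i + 1 + L) + \<bar>compensated \<omega> (min 1 (\<tau> n \<omega>))\<bar>"
          by auto
        then show "norm (?S m \<omega>) \<le> 2 * (real i + 1 + L) + \<bar>compensated \<omega> (min 1 (\<tau> n \<omega>))\<bar>"
          using L(1) by (auto simp: indicator_def)
      qed
    qed (use D_meas meas in auto)
    moreover have "(\<integral>\<omega>. ?S m \<omega> \<partial>P) = 0" for m using ls(2)[of "Suc m"] by auto
    ultimately have "(\<integral>\<omega>. ?D n \<omega> \<partial>P) = 0" by (simp add: LIMSEQ_const_iff)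
    with D_meas show ?thesis by blast
  qed
  \<comment> \<open>An indicator minus a time integral of the intensity at the single level
    \<open>i\<close>: bounded uniformly in the path, unlike \<open>compensated\<close>.\<close>
  have V_bound: "\<bar>?V \<omega> x\<bar> \<le> 1 + L" if "\<omega> \<in> Omega" "x \<in> {0..1}" for \<omega> x
  proof -
    have "0 \<le> integral {0..x} (occ i \<omega>) \<and> integral {0..x} (occ i \<omega>) \<le> L * (x - 0)"
    proof (intro integral_le_bound occ_integrable that(1))
      fix r assume "r \<in> {0..x}"
      then have "r \<in> {0..1}" using that by auto
      then show "0 \<le> occ i \<omega> r \<and> occ i \<omega> r \<le> L" using L(2)[of r i] l_pos[of r i] by (auto simp: occ_def)
    qed (use that in auto)
    moreover have "L * x \<le> L * 1" using that L(1) by (intro mult_left_mono) auto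
    ultimately show ?thesis by (auto simp: compensated_level_def)
  qed
  have V_meas: "(\<lambda>\<omega>. ?V \<omega> x) \<in> borel_measurable P" if "x \<in> {0..1}" for x
  proof -
    have "(\<lambda>\<omega>. indicator {\<omega>\<in>Omega. i < \<omega> x} \<omega> - integral {0..x} (occ i \<omega>) :: real) \<in> borel_measurable P"
      using that level_sets[OF that] by (intro borel_measurable_diff occ_integral_measurable[OF A_sets]) auto
    then show ?thesis
      by (rule measurable_cong[THEN iffD1, rotated]) (simp add: compensated_level_def indicator_def)
  qed
  have "(\<lambda>n. \<integral>\<omega>. ?D n \<omega> \<partial>P) \<longlonglongrightarrow> (\<integral>\<omega>. indicator A \<omega> * (?V \<omega> t - ?V \<omega> s) \<partial>P)"
  proof (rule integral_dominated_convergence)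
    show "(\<lambda>\<omega>. indicator A \<omega> * (?V \<omega> t - ?V \<omega> s)) \<in> borel_measurable P"
      using A_sets V_meas st by (intro borel_measurable_times borel_measurable_diff) auto
    show "?D n \<in> borel_measurable P" for n using step by blast
    show "integrable P (\<lambda>_. 2 * (1 + L))" by simp
    show "AE \<omega> in P. (\<lambda>n. ?D n \<omega>) \<longlonglongrightarrow> indicator A \<omega> * (?V \<omega> t - ?V \<omega> s)"
      using ae
    proof eventually_elim
      case (elim \<omega>)
      then have "eventually (\<lambda>n. ?D n \<omega> = indicator A \<omega> * (?V \<omega> t - ?V \<omega> s)) sequentially"
        by eventually_elim (use st in \<open>simp add: min_def\<close>)
      then show ?case by (rule tendsto_eventually)
    qed
    show "AE \<omega> in P. norm (?D n \<omega>) \<le> 2 * (1 + L)" for n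
    proof (rule AE_I2)
      fix \<omega> assume "\<omega> \<in> space P"
      then have \<omega>: "\<omega> \<in> Omega" by simp
      have "\<bar>?V \<omega> (min t (\<tau> n \<omega>))\<bar> \<le> 1 + L" "\<bar>?V \<omega> (min s (\<tau> n \<omega>))\<bar> \<le> 1 + L"
        using \<tau>01[OF \<omega>, of n] st by (auto intro!: V_bound[OF \<omega>])
      then show "norm (?D n \<omega>) \<le> 2 * (1 + L)" using L(1) by (auto simp: indicator_def)
    qed
  qed
  then show ?thesis using step by (simp add: LIMSEQ_const_iff)
qed

text \<open>The centred increment of \<open>compensated_level\<close> is written out, and its
  integral term is evaluated by \<open>expectation_occ\<close>. Stated for tails, since only jumps
  from \<open>i\<close> change the event of being above \<open>i\<close>.\<close>

lemma forward_equation: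
  assumes st: "0 \<le> s" "s \<le> t" "t \<le> 1" and A: "A \<in> Fsig s"
  shows "measure P (A \<inter> {\<omega>\<in>Omega. i < \<omega> t}) = measure P (A \<inter> {\<omega>\<in>Omega. i < \<omega> s}) +
    integral {s..t} (\<lambda>r. l r i * measure P (A \<inter> {\<omega>\<in>Omega. \<omega> r = i}))"
proof -
  have A_sets: "A \<in> sets P" using st by (intro Fsig_sets[OF _ A]) auto
  have sets: "A \<inter> {\<omega>\<in>Omega. i < \<omega> u} \<in> sets P" if "u \<in> {0..1}" for u
    using A_sets level_sets[OF that] by auto
  have occ_meas: "(\<lambda>\<omega>. integral {s..t} (occ i \<omega>)) \<in> borel_measurable P"
    using occ_integral_measurable[OF A_sets st(1,3)] .
  obtain L where L: "L > 0" "\<And>r x. r \<in> {0..1} \<Longrightarrow> x \<le> i \<Longrightarrow> l r x \<le> L"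
    using bound_up_to[of i] by blast
  have occ_int: "integrable P (\<lambda>\<omega>. indicator A \<omega> * integral {s..t} (occ i \<omega>))"
  proof (rule integrable_const_bound[where B = "L * (t - s)"])
    show "AE \<omega> in P. norm (indicator A \<omega> * integral {s..t} (occ i \<omega>)) \<le> L * (t - s)"
    proof (rule AE_I2)
      fix \<omega> assume "\<omega> \<in> space P"
      then have \<omega>: "\<omega> \<in> Omega" by simp
      have "0 \<le> integral {s..t} (occ i \<omega>) \<and> integral {s..t} (occ i \<omega>) \<le> L * (t - s)"
      proof (intro integral_le_bound occ_integrable \<omega>)
        fix r assume "r \<in> {s..t}"
        then have "r \<in> {0..1}" using st by auto
        then show "0 \<le> occ i \<omega> r \<and> occ i \<omega> r \<le> L" using L(2)[of r i] l_pos[of r i] by (auto simp: occ_def)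
      qed (use st in auto)
      then show "norm (indicator A \<omega> * integral {s..t} (occ i \<omega>)) \<le> L * (t - s)"
        using L(1) st by (auto simp: indicator_def)
    qed
    show "(\<lambda>\<omega>. indicator A \<omega> * integral {s..t} (occ i \<omega>)) \<in> borel_measurable P"
      using A_sets occ_meas by (intro borel_measurable_times) auto
  qed
  have "(\<integral>\<omega>. indicator A \<omega> * (compensated_level i \<omega> t - compensated_level i \<omega> s) \<partial>P) =
    (\<integral>\<omega>. indicator (A \<inter> {\<omega>\<in>Omega. i < \<omega> t}) \<omega> - indicator (A \<inter> {\<omega>\<in>Omega. i < \<omega> s}) \<omega> -
      indicator A \<omega> * integral {s..t} (occ i \<omega>) \<partial>P)"
    using st by (intro Bochner_Integration.integral_cong)
      (auto simp: compensated_level_diff indicator_def)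
  also have "\<dots> = measure P (A \<inter> {\<omega>\<in>Omega. i < \<omega> t}) - measure P (A \<inter> {\<omega>\<in>Omega. i < \<omega> s}) -
      (\<integral>\<omega>. indicator A \<omega> * integral {s..t} (occ i \<omega>) \<partial>P)"
  proof -
    have "A \<inter> {\<omega>\<in>Omega. i < \<omega> u} \<inter> Omega = A \<inter> {\<omega>\<in>Omega. i < \<omega> u}" for u by auto
    then show ?thesis using sets[of s] sets[of t] st occ_int by (simp add: emeasure_eq_measure)
  qed
  finally show ?thesis
    using compensated_level_expectation[OF st A, of i] expectation_occ[OF A_sets st(1,3), of i] by simp
qed

end

subsection \<open>Transition probabilities\<close>

lemma nonneg_derivative_imp_ge:
  fixes f :: "real \<Rightarrow> real"
  assumes der: "\<And>x. x \<in> {a..b} \<Longrightarrow> (f has_real_derivative f' x) (at x within {a..b})"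
    and nonneg: "\<And>x. x \<in> {a..b} \<Longrightarrow> 0 \<le> f' x" and t: "t \<in> {a..b}"
  shows "f a \<le> f t"
proof -
  have "(f has_derivative (\<lambda>h. f' x * h)) (at x within {a..t})" if "a \<le> x" "x \<le> t" for x
    using has_field_derivative_subset[OF der[of x], of "{a..t}"] that t
    by (auto simp: has_field_derivative_def)
  then have "\<exists>x\<in>{a..t}. f t - f a = f' x * (t - a)"
    using t by (intro mvt_very_simple) auto
  then obtain x where "x \<in> {a..t}" "f t - f a = f' x * (t - a)" by blast
  moreover from this have "0 \<le> f' x * (t - a)" using nonneg[of x] t by auto
  ultimately show ?thesis by linarith
qed

text \<open>With rates exactly \<open>c j * e t\<close> the chain is solved in closed form: each
  integration raises the power of \<open>E t - E s\<close> by one. Nonnegative rates make the chain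
  monotone, so bounds on the rates carry over to the solution by induction.\<close>

lemma birth_chain_bounds:
  fixes q :: "nat \<Rightarrow> real \<Rightarrow> real"
  assumes der: "\<And>j t. n \<le> j \<Longrightarrow> t \<in> {s..u} \<Longrightarrow>
      (q (Suc j) has_real_derivative \<phi> j t * q j t) (at t within {s..u})"
    and base: "\<And>t. t \<in> {s..u} \<Longrightarrow> q n t = Q"
    and init: "\<And>j. n < j \<Longrightarrow> q j s = 0" and Q: "0 \<le> Q"
    and E: "\<And>t. t \<in> {s..u} \<Longrightarrow> (E has_real_derivative e t) (at t within {s..u})"
    and e: "\<And>t. t \<in> {s..u} \<Longrightarrow> 0 \<le> e t"
    and a: "\<And>j. 0 \<le> a j" and lower: "\<And>j t. t \<in> {s..u} \<Longrightarrow> a j * e t \<le> \<phi> j t"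
    and upper: "\<And>j t. t \<in> {s..u} \<Longrightarrow> \<phi> j t \<le> b j * e t"
    and t: "t \<in> {s..u}"
  shows "Q * prod a {n..<n+k} * (E t - E s) ^ k / fact k \<le> q (n + k) t \<and>
    q (n + k) t \<le> Q * prod b {n..<n+k} * (E t - E s) ^ k / fact k"
  using t
proof (induction k arbitrary: t)
  case 0
  then show ?case using base by simp
next
  case (Suc k)
  have Es: "E s \<le> E x" if "x \<in> {s..u}" for x
    using nonneg_derivative_imp_ge[OF E e that] .
  \<comment> \<open>\<open>y c\<close> and \<open>z c\<close> are the explicit solutions with rates
    \<open>c j * e\<close> at the consecutive levels \<open>n + k\<close> and
    \<open>n + k + 1\<close>.\<close>
  define y where "y c x = Q * prod c {n..<n+k} * (E x - E s) ^ k / fact k" for c :: "nat \<Rightarrow> real" and x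
  define z where "z c x = Q * prod c {n..<n+Suc k} * (E x - E s) ^ Suc k / fact (Suc k)" for c :: "nat \<Rightarrow> real" and x
  have z0: "z c s = 0" for c by (simp add: z_def)
  have z_der: "(z c has_real_derivative (c (n + k) * e x) * y c x) (at x within {s..u})"
    if "x \<in> {s..u}" for c x
  proof -
    have "((\<lambda>x. (E x - E s) ^ Suc k) has_real_derivative real (Suc k) * (e x * (E x - E s) ^ k)) (at x within {s..u})"
      using DERIV_power_Suc[OF DERIV_diff[OF E[OF that] DERIV_const], of "E s" k] by (simp add: mult_ac)
    from DERIV_cmult[OF this, of "Q * prod c {n..<n+Suc k} / fact (Suc k)"]
    have "((\<lambda>x. Q * prod c {n..<n+Suc k} / fact (Suc k) * (E x - E s) ^ Suc k) has_real_derivative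
      Q * prod c {n..<n+Suc k} / fact (Suc k) * (real (Suc k) * (e x * (E x - E s) ^ k))) (at x within {s..u})" .
    moreover have "Q * prod c {n..<n+Suc k} / fact (Suc k) * (real (Suc k) * (e x * (E x - E s) ^ k)) =
      (c (n + k) * e x) * y c x"
    proof -
      have "X / fact (Suc k) * (real (Suc k) * Y) = X * Y / fact k" for X Y :: real
        by (simp add: field_simps del: of_nat_Suc)
      then show ?thesis by (simp add: y_def)
    qed
    ultimately show ?thesis by (simp add: z_def[abs_def] del: prod.op_ivl_Suc)
  qed
  have q_der: "(q (Suc (n + k)) has_real_derivative \<phi> (n + k) x * q (n + k) x) (at x within {s..u})"
    if "x \<in> {s..u}" for x using der[of "n + k" x] that by simp
  have IH: "y a x \<le> q (n + k) x" "q (n + k) x \<le> y b x" "0 \<le> y a x" "0 \<le> q (n + k) x" if "x \<in> {s..u}" for x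
  proof -
    show 1: "y a x \<le> q (n + k) x" "q (n + k) x \<le> y b x" using Suc.IH[OF that] by (auto simp: y_def)
    show "0 \<le> y a x" unfolding y_def
      using Q a Es[OF that] by (intro divide_nonneg_nonneg mult_nonneg_nonneg prod_nonneg zero_le_power) auto
    with 1 show "0 \<le> q (n + k) x" by linarith
  qed
  have "q (Suc (n + k)) s - z a s \<le> q (Suc (n + k)) t - z a t"
  proof (rule nonneg_derivative_imp_ge[OF DERIV_diff[OF q_der z_der]])
    fix x assume x: "x \<in> {s..u}"
    have "(a (n + k) * e x) * y a x \<le> \<phi> (n + k) x * q (n + k) x"
      using lower[OF x, of "n + k"] IH[OF x] e[OF x] a[of "n + k"]
      by (intro mult_mono) (auto intro: order_trans[OF mult_nonneg_nonneg])
    then show "0 \<le> \<phi> (n + k) x * q (n + k) x - (a (n + k) * e x) * y a x" by simp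
  qed (use Suc.prems in auto)
  moreover have "z b s - q (Suc (n + k)) s \<le> z b t - q (Suc (n + k)) t"
  proof (rule nonneg_derivative_imp_ge[OF DERIV_diff[OF z_der q_der]])
    fix x assume x: "x \<in> {s..u}"
    have "0 \<le> a (n + k) * e x" using a e[OF x] by simp
    then have "0 \<le> b (n + k) * e x" using lower[OF x, of "n + k"] upper[OF x, of "n + k"] by linarith
    then have "\<phi> (n + k) x * q (n + k) x \<le> (b (n + k) * e x) * y b x"
      using upper[OF x, of "n + k"] IH[OF x] by (intro mult_mono) auto
    then show "0 \<le> (b (n + k) * e x) * y b x - \<phi> (n + k) x * q (n + k) x" by simp
  qed (use Suc.prems in auto)
  ultimately show ?case using init[of "Suc (n + k)"] by (simp add: z0) (simp add: z_def)
qed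

section \<open>The limit profile \<open>pi_lam\<close> and its slope at time 0\<close>

definition pi_speed :: "real \<Rightarrow> real" where
  "pi_speed lam = (if lam = 0 then 1 else lam / (exp lam - 1))"

lemma pi_speed_pos: "0 < pi_speed lam"
proof -
  consider "lam = 0" | "lam > 0" | "lam < 0" by linarith
  then show ?thesis
    by cases (auto simp: pi_speed_def zero_less_divide_iff)
qed

lemma pi_lam_0 [simp]: "pi_lam lam 0 = 0" and pi_lam_1 [simp]: "pi_lam lam 1 = 1"
  by (auto simp: pi_lam_def)

lemma pi_lam_deriv: "(pi_lam lam has_real_derivative pi_speed lam * exp (lam * t)) (at t within S)"
proof (cases "lam = 0")
  case True
  then have "pi_lam lam = (\<lambda>t. t)" by (auto simp: pi_lam_def)
  then show ?thesis using True by (simp add: pi_speed_def)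
next
  case False
  have "((\<lambda>t. (exp (lam * t) - 1) / (exp lam - 1)) has_real_derivative
      (exp (lam * t) * lam) / (exp lam - 1)) (at t within S)"
    using False by (auto intro!: derivative_eq_intros)
  moreover have "pi_lam lam = (\<lambda>t. (exp (lam * t) - 1) / (exp lam - 1))"
    using False by (auto simp: pi_lam_def)
  ultimately show ?thesis using False by (simp add: pi_speed_def mult.commute)
qed

lemma pi_lam_mono: "s \<le> t \<Longrightarrow> pi_lam lam s \<le> pi_lam lam t"
  using nonneg_derivative_imp_ge[of s t "pi_lam lam" "\<lambda>x. pi_speed lam * exp (lam * x)" t] pi_lam_deriv pi_speed_pos[of lam]
  by auto

lemma pi_lam_in: "t \<in> {0..1} \<Longrightarrow> pi_lam lam t \<in> {0..1}"
  using pi_lam_mono[of 0 t lam] pi_lam_mono[of t 1 lam] by auto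

lemma pi_lam_continuous: "continuous_on S (pi_lam lam)"
  using pi_lam_deriv by (rule DERIV_continuous_on)

section \<open>The gauge factors and the rates they produce\<close>

context jump_intensity
begin

text \<open>\<open>exp (- cum j t)\<close> is the probability of no jump up to \<open>t\<close> for
  a process at level \<open>j\<close>; multiplying by \<open>exp (cum j t)\<close> removes the loss
  term from the forward equation.\<close>

definition cum :: "nat \<Rightarrow> real \<Rightarrow> real" where
  "cum j t = integral {0..t} (\<lambda>r. l r j)"

lemma cum_deriv:
  assumes "t \<in> {s..1}" "0 \<le> s"
  shows "(cum j has_real_derivative l t j) (at t within {s..1})"
proof -
  have "(cum j has_real_derivative l t j) (at t within {0..1})"
    unfolding cum_def[abs_def] using assms by (intro integral_has_real_derivative l_cont) auto
  then show ?thesis by (rule has_field_derivative_subset) (use assms in auto)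
qed

text \<open>The coefficient linking consecutive gauged level probabilities: the jump rate times the
  quotient of the two gauge factors.\<close>

definition gauge_rate :: "nat \<Rightarrow> real \<Rightarrow> real" where
  "gauge_rate j t = l t j * exp (cum (Suc j) t - cum j t)"

lemma ln_intensity_deriv:
  assumes "x \<in> {0..1}" "((\<lambda>s. l s j) has_real_derivative d) (at x within {0..1})"
  shows "((\<lambda>x. ln (l x j)) has_real_derivative d / l x j) (at x within {0..1})"
  using assms(2) l_pos[OF assms(1), of j] by (auto intro!: derivative_eq_intros)

lemma Xi_eq:
  assumes "x \<in> {0..1}" "((\<lambda>s. l s j) has_real_derivative d) (at x within {0..1})"
  shows "Xi l x j = d / l x j + l x (Suc j) - l x j"
  unfolding Xi_def using ln_intensity_deriv[OF assms] assms(1)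
  by (subst vector_derivative_within_closed_interval) (auto simp: has_real_derivative_iff_has_vector_derivative)

text \<open>The logarithmic derivative of \<^const>\<open>gauge_rate\<close> is the reciprocal characteristic.\<close>

lemma gauge_rate_bounds:
  assumes l': "\<And>t. t \<in> {0..1} \<Longrightarrow> ((\<lambda>s. l s j) has_real_derivative l' t) (at t within {0..1})"
    and \<delta>: "\<And>t. t \<in> {0..1} \<Longrightarrow> \<bar>Xi l t j - lam\<bar> \<le> \<delta>" and t: "t \<in> {0..1}"
  shows "l 0 j * exp (- \<delta>) * exp (lam * t) \<le> gauge_rate j t \<and>
    gauge_rate j t \<le> l 0 j * exp \<delta> * exp (lam * t)"
proof -
  \<comment> \<open>The logarithm of \<open>gauge_rate j x\<close> minus \<open>lam * x\<close>. Its
    derivative is \<open>Xi l x j - lam\<close>, so both \<open>H x + \<delta> * x\<close> and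
    \<open>\<delta> * x - H x\<close> are nondecreasing.\<close>
  define H where "H x = ln (l x j) + (cum (Suc j) x - cum j x) - lam * x" for x
  note ln_der = ln_intensity_deriv[OF _ l'] and Xi = Xi_eq[OF _ l']
  have H_der: "(H has_real_derivative Xi l x j - lam) (at x within {0..1})" if "x \<in> {0..1}" for x
  proof -
    have "(H has_real_derivative l' x / l x j + (l x (Suc j) - l x j) - lam * 1) (at x within {0..1})"
      unfolding H_def[abs_def]
      by (intro DERIV_diff DERIV_add ln_der cum_deriv DERIV_cmult DERIV_ident that) (use that in auto)
    then show ?thesis using Xi[OF that that] by (simp add: add_diff_eq)
  qed
  have H0: "H 0 = ln (l 0 j)" by (simp add: H_def cum_def)
  have "\<delta> \<ge> 0" using \<delta>[OF t] by linarith
  then have \<delta>t: "\<delta> * t \<le> \<delta> * 1" using t by (intro mult_left_mono) auto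
  have lin: "((\<lambda>x. \<delta> * x) has_real_derivative \<delta>) (at x within {0..1})" for x
    using DERIV_cmult[OF DERIV_ident, of \<delta>] by simp
  have "H 0 + \<delta> * 0 \<le> H t + \<delta> * t"
    using \<delta> by (intro nonneg_derivative_imp_ge[OF DERIV_add[OF H_der lin] _ t]) fastforce+
  then have lo: "ln (l 0 j) - \<delta> \<le> H t" using H0 \<delta>t by simp
  have "\<delta> * 0 - H 0 \<le> \<delta> * t - H t"
    using \<delta> by (intro nonneg_derivative_imp_ge[OF DERIV_diff[OF lin H_der] _ t]) fastforce+
  then have hi: "H t \<le> ln (l 0 j) + \<delta>" using H0 \<delta>t by simp
  have l0: "exp (ln (l 0 j)) = l 0 j" using l_pos[of 0 j] by simp
  have lt: "exp (ln (l t j)) = l t j" using l_pos[OF t, of j] by simp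
  have g: "gauge_rate j t = exp (H t + lam * t)"
    unfolding H_def gauge_rate_def using lt by (simp add: exp_add exp_diff)
  have "l 0 j * exp (- \<delta>) * exp (lam * t) = exp (ln (l 0 j) - \<delta> + lam * t)"
    using l0 by (simp add: exp_add exp_diff exp_minus field_simps)
  moreover have "l 0 j * exp \<delta> * exp (lam * t) = exp (ln (l 0 j) + \<delta> + lam * t)"
    using l0 by (simp add: exp_add)
  ultimately show ?thesis unfolding g using lo hi by simp
qed

end

section \<open>Differential equations and bounds for level probabilities\<close>

context markov_counting
begin

text \<open>Level probabilities are differences of the tails \<open>G\<close>. The integral form of
  the forward equation first gives continuity, and the fundamental theorem of calculus then applies
  to a continuous integrand.\<close>

lemma level_prob_derivative:
  assumes s: "0 \<le> s" and A: "A \<in> Fsig s" and t: "t \<in> {s..1}"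
  defines "F \<equiv> \<lambda>j t. measure P (A \<inter> {\<omega>\<in>Omega. \<omega> t = j})"
  shows "(F 0 has_real_derivative - (l t 0 * F 0 t)) (at t within {s..1})"
    and "(F (Suc j) has_real_derivative l t j * F j t - l t (Suc j) * F (Suc j) t) (at t within {s..1})"
proof -
  have s1: "s \<le> 1" using t by auto
  have A_sets: "A \<in> sets P" using s1 by (intro Fsig_sets[OF _ A])
  then have A_sub: "A \<subseteq> Omega" using sets.sets_into_space by fastforce
  define G where "G j t = measure P (A \<inter> {\<omega>\<in>Omega. j < \<omega> t})" for j t
  have sets: "A \<inter> {\<omega>\<in>Omega. Q (\<omega> x)} \<in> sets P" if "x \<in> {s..1}" for x Q
    using A_sets level_sets[of x Q] that s by auto
  have F0: "F 0 x = measure P A - G 0 x" if "x \<in> {s..1}" for x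
  proof -
    have "measure P A = measure P ((A \<inter> {\<omega>\<in>Omega. \<omega> x = 0}) \<union> (A \<inter> {\<omega>\<in>Omega. 0 < \<omega> x}))"
      using A_sub by (intro arg_cong[where f = "measure P"]) auto
    also have "\<dots> = F 0 x + G 0 x"
      unfolding F_def G_def using sets[OF that] by (intro finite_measure_Union) auto
    finally show ?thesis by simp
  qed
  have FS: "F (Suc j) x = G j x - G (Suc j) x" if "x \<in> {s..1}" for j x
  proof -
    have "G j x = measure P ((A \<inter> {\<omega>\<in>Omega. \<omega> x = Suc j}) \<union> (A \<inter> {\<omega>\<in>Omega. Suc j < \<omega> x}))"
      unfolding G_def by (intro arg_cong[where f = "measure P"]) auto
    also have "\<dots> = F (Suc j) x + G (Suc j) x"
      unfolding F_def G_def using sets[OF that] by (intro finite_measure_Union) auto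
    finally show ?thesis by simp
  qed
  have G: "G j x = G j s + integral {s..x} (\<lambda>r. l r j * F j r)" if "x \<in> {s..1}" for j x
    unfolding G_def F_def using that s by (intro forward_equation A) auto
  have int: "(\<lambda>r. l r j * F j r) integrable_on {s..1}" for j
    unfolding F_def using s by (intro occ_prob_integrable[OF A_sets]) auto
  \<comment> \<open>Here integrability of \<open>l r j * F j r\<close> suffices; its continuity is
    available only after this step.\<close>
  have G_cont: "continuous_on {s..1} (G j)" for j
  proof -
    have "continuous_on {s..1} (\<lambda>x. G j s + integral {s..x} (\<lambda>r. l r j * F j r))"
      by (intro continuous_intros indefinite_integral_continuous_1 int)
    then show ?thesis by (rule continuous_on_eq) (rule G[symmetric])
  qed
  have F_cont: "continuous_on {s..1} (F j)" for j
  proof (cases j)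
    case 0
    have "continuous_on {s..1} (\<lambda>x. measure P A - G 0 x)" by (intro continuous_intros G_cont)
    then show ?thesis unfolding 0 by (rule continuous_on_eq) (simp add: F0)
  next
    case (Suc k)
    have "continuous_on {s..1} (\<lambda>x. G k x - G (Suc k) x)" by (intro continuous_intros G_cont)
    then show ?thesis unfolding Suc by (rule continuous_on_eq) (simp add: FS)
  qed
  have "continuous_on {s..1} (\<lambda>r. l r j)" for j
    using l_cont by (rule continuous_on_subset) (use s in auto)
  then have "continuous_on {s..1} (\<lambda>r. l r j * F j r)" for j
    by (intro continuous_intros F_cont)
  then have I_der: "((\<lambda>x. integral {s..x} (\<lambda>r. l r j * F j r)) has_real_derivative l t j * F j t) (at t within {s..1})" for j
    using t by (intro integral_has_real_derivative)
  have G_der: "(G j has_real_derivative l t j * F j t) (at t within {s..1})" for j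
  proof -
    have "((\<lambda>x. G j s + integral {s..x} (\<lambda>r. l r j * F j r)) has_real_derivative 0 + l t j * F j t) (at t within {s..1})"
      by (intro DERIV_add DERIV_const I_der)
    then have "((\<lambda>x. G j s + integral {s..x} (\<lambda>r. l r j * F j r)) has_real_derivative l t j * F j t) (at t within {s..1})"
      by simp
    then show ?thesis
      by (rule has_field_derivative_transform_within[OF _ zero_less_one t]) (rule G[symmetric])
  qed
  have "((\<lambda>x. measure P A - G 0 x) has_real_derivative 0 - l t 0 * F 0 t) (at t within {s..1})"
    by (intro DERIV_diff DERIV_const G_der)
  then show "(F 0 has_real_derivative - (l t 0 * F 0 t)) (at t within {s..1})"
    using F0 t by (auto intro: has_field_derivative_transform_within[OF _ zero_less_one])
  have "((\<lambda>x. G j x - G (Suc j) x) has_real_derivative l t j * F j t - l t (Suc j) * F (Suc j) t) (at t within {s..1})"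
    by (intro DERIV_diff G_der)
  then show "(F (Suc j) has_real_derivative l t j * F j t - l t (Suc j) * F (Suc j) t) (at t within {s..1})"
    using FS t by (auto intro: has_field_derivative_transform_within[OF _ zero_less_one])
qed

text \<open>The gauged level probabilities form a birth chain started at level \<open>n\<close> at
  time \<open>s\<close>, with rates comparable to multiples of the derivative of
  \<open>pi_lam\<close>. As \<open>A\<close> is any past event fixing the state, the estimate can be
  chained over successive intervals.\<close>

lemma transition_bounds:
  fixes k :: nat
  assumes s: "0 \<le> s" and A: "A \<in> Fsig s" "\<And>\<omega>. \<omega> \<in> A \<Longrightarrow> \<omega> s = n" and t: "t \<in> {s..1}"
    and l': "\<And>z t. t \<in> {0..1} \<Longrightarrow> ((\<lambda>s. l s z) has_real_derivative l' z t) (at t within {0..1})"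
    and \<delta>: "\<And>z t. t \<in> {0..1} \<Longrightarrow> \<bar>Xi l t z - lam\<bar> \<le> \<delta> z"
  defines "a \<equiv> \<lambda>j. l 0 j / pi_speed lam * exp (- \<delta> j)" and "b \<equiv> \<lambda>j. l 0 j / pi_speed lam * exp (\<delta> j)"
    and "Q \<equiv> measure P A * exp (cum n s)"
    and "w \<equiv> measure P (A \<inter> {\<omega>\<in>Omega. \<omega> t = n + k}) * exp (cum (n + k) t)"
  shows "Q * prod a {n..<n+k} * (pi_lam lam t - pi_lam lam s) ^ k / fact k \<le> w"
    and "w \<le> Q * prod b {n..<n+k} * (pi_lam lam t - pi_lam lam s) ^ k / fact k"
proof -
  define F where "F j t = measure P (A \<inter> {\<omega>\<in>Omega. \<omega> t = j})" for j t
  define q where "q j t = F j t * exp (cum j t)" for j t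
  have s1: "s \<le> 1" using t by auto
  have A_sets: "A \<in> sets P" using s1 by (intro Fsig_sets[OF _ A(1)])
  then have A_sub: "A \<subseteq> Omega" using sets.sets_into_space by fastforce
  have F_der: "(F 0 has_real_derivative - (l x 0 * F 0 x)) (at x within {s..1})"
    "(F (Suc j) has_real_derivative l x j * F j x - l x (Suc j) * F (Suc j) x) (at x within {s..1})"
    if "x \<in> {s..1}" for x j
    unfolding F_def[abs_def] using level_prob_derivative[OF s A(1) that] by auto
  have exp_der: "((\<lambda>x. exp (cum j x)) has_real_derivative exp (cum j x) * l x j) (at x within {s..1})"
    if "x \<in> {s..1}" for j x
    using DERIV_chain'[OF cum_deriv[OF that s] DERIV_exp] by (simp add: mult.commute)
  have q0: "(q 0 has_real_derivative 0) (at x within {s..1})" if "x \<in> {s..1}" for x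
    using DERIV_mult[OF F_der(1)[OF that] exp_der[OF that, of 0]] by (simp add: q_def[abs_def] algebra_simps)
  \<comment> \<open>Differentiating the gauge factor cancels the loss term at level
    \<open>j + 1\<close>; only the inflow from \<open>j\<close> survives.\<close>
  have qS: "(q (Suc j) has_real_derivative gauge_rate j x * q j x) (at x within {s..1})" if "x \<in> {s..1}" for j x
  proof -
    have "(q (Suc j) has_real_derivative
      (l x j * F j x - l x (Suc j) * F (Suc j) x) * exp (cum (Suc j) x) + exp (cum (Suc j) x) * l x (Suc j) * F (Suc j) x)
      (at x within {s..1})"
      using DERIV_mult[OF F_der(2)[OF that] exp_der[OF that, of "Suc j"]] by (simp add: q_def[abs_def])
    moreover have "gauge_rate j x * q j x = l x j * F j x * exp (cum (Suc j) x)"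
      by (simp add: gauge_rate_def q_def exp_diff)
    ultimately show ?thesis by (simp add: algebra_simps)
  qed
  have below: "F j x = 0" if "j < n" "x \<in> {s..1}" for j x
  proof -
    have "A \<inter> {\<omega>\<in>Omega. \<omega> x = j} = {}"
    proof (intro equals0I)
      fix \<omega> assume "\<omega> \<in> A \<inter> {\<omega>\<in>Omega. \<omega> x = j}"
      then show False using A(2)[of \<omega>] Omega_mono[of \<omega> s x] that by auto
    qed
    then show ?thesis by (simp add: F_def)
  qed
  \<comment> \<open>No path in \<open>A\<close> is below \<open>n\<close> after time
    \<open>s\<close>, so the starting level has no inflow and its gauged probability is
    constant.\<close>
  have q_der_n: "(q n has_real_derivative 0) (at x within {s..1})" if "x \<in> {s..1}" for x
  proof (cases n)
    case 0
    then show ?thesis using q0[OF that] by simp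
  next
    case (Suc m)
    then show ?thesis using qS[OF that, of m] below[of m x] that by (simp add: q_def)
  qed
  have base: "q n x = Q" if "x \<in> {s..1}" for x
  proof -
    have "q n s \<le> q n x" by (rule nonneg_derivative_imp_ge[OF q_der_n _ that]) auto
    moreover have "- q n s \<le> - q n x"
      by (rule nonneg_derivative_imp_ge[OF DERIV_minus[OF q_der_n] _ that]) auto
    moreover have "A \<inter> {\<omega>\<in>Omega. \<omega> s = n} = A" using A(2) A_sub by auto
    then have "q n s = Q" by (simp add: q_def F_def Q_def)
    ultimately show ?thesis by simp
  qed
  have init: "q j s = 0" if "n < j" for j
  proof -
    have "A \<inter> {\<omega>\<in>Omega. \<omega> s = j} = {}" using A(2) that by auto
    then show ?thesis by (simp add: q_def F_def)
  qed
  have Q: "0 \<le> Q" by (simp add: Q_def)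
  have \<kappa>: "0 < pi_speed lam" by (rule pi_speed_pos)
  have a0: "0 \<le> a j" for j using l_pos[of 0 j] \<kappa> by (simp add: a_def)
  \<comment> \<open>The division by \<open>pi_speed lam\<close> in \<open>a\<close> and
    \<open>b\<close> compensates the factor in the derivative of \<open>pi_lam\<close>.\<close>
  have lower: "a j * (pi_speed lam * exp (lam * x)) \<le> gauge_rate j x"
    and upper: "gauge_rate j x \<le> b j * (pi_speed lam * exp (lam * x))" if "x \<in> {s..1}" for j x
    using gauge_rate_bounds[OF l' \<delta>, of x j] that s \<kappa> by (simp_all add: a_def b_def mult.assoc)
  have e: "0 \<le> pi_speed lam * exp (lam * x)" for x using \<kappa> by simp
  from birth_chain_bounds[where q = q and \<phi> = gauge_rate and E = "pi_lam lam"
      and e = "\<lambda>x. pi_speed lam * exp (lam * x)" and a = a and b = b and n = n and k = k,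
      OF qS base init Q pi_lam_deriv e a0 lower upper t]
  show "Q * prod a {n..<n+k} * (pi_lam lam t - pi_lam lam s) ^ k / fact k \<le> w"
    "w \<le> Q * prod b {n..<n+k} * (pi_lam lam t - pi_lam lam s) ^ k / fact k"
    by (auto simp: q_def F_def w_def)
qed

end

subsection \<open>Concentration of the bridges\<close>

lemma cesaro_le:
  fixes \<delta> :: "nat \<Rightarrow> real"
  assumes "\<delta> \<longlonglongrightarrow> 0" and c: "c > 0"
  shows "eventually (\<lambda>N. (\<Sum>j<N. \<delta> j) \<le> c * real N) sequentially"
proof -
  have "eventually (\<lambda>j. \<delta> j < c / 2) sequentially"
    using assms by (intro order_tendstoD) auto
  then obtain N0 where N0: "\<And>j. j \<ge> N0 \<Longrightarrow> \<delta> j < c / 2"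
    unfolding eventually_sequentially by blast
  define K where "K = (\<Sum>j<N0. \<delta> j)"
  \<comment> \<open>Half of the allowance \<open>c * real N\<close> covers the tail terms, the other
    half the fixed initial block \<open>K\<close> once \<open>N\<close> is at least
    \<open>N1\<close>.\<close>
  obtain N1 :: nat where N1: "2 * K / c \<le> real N1" using real_arch_simple by blast
  have "(\<Sum>j<N. \<delta> j) \<le> c * real N" if N: "N \<ge> max N0 N1" for N
  proof -
    have "{..<N} = {..<N0} \<union> {N0..<N}" using N by auto
    then have "(\<Sum>j<N. \<delta> j) = K + (\<Sum>j=N0..<N. \<delta> j)"
      unfolding K_def by (simp add: sum.union_disjoint ivl_disj_int_one)
    also have "(\<Sum>j=N0..<N. \<delta> j) \<le> (\<Sum>j=N0..<N. c / 2)"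
      using N0 by (intro sum_mono) (auto simp: less_imp_le)
    also have "\<dots> \<le> c / 2 * real N"
      using c by (simp add: mult.commute mult_left_mono)
    also have "K \<le> c / 2 * real N"
    proof -
      have "2 * K / c \<le> real N" using N N1 by simp
      then show ?thesis using c by (simp add: field_simps)
    qed
    finally show ?thesis by simp
  qed
  then show ?thesis unfolding eventually_sequentially by blast
qed

lemma sup_deviation_grid:
  fixes m :: nat
  assumes \<omega>: "\<omega> \<in> Omega" and m: "m > 0"
    and mesh: "\<And>k. k < m \<Longrightarrow> pi_lam lam (real (Suc k) / real m) - pi_lam lam (real k / real m) \<le> \<eta>"
    and close: "\<And>k. k \<le> m \<Longrightarrow> \<bar>real (\<omega> (real k / real m)) / c - pi_lam lam (real k / real m)\<bar> \<le> \<eta>"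
    and c: "c \<ge> 0"
  shows "(SUP t\<in>{0..1}. \<bar>real (\<omega> t) / c - pi_lam lam t\<bar>) \<le> 2 * \<eta>"
proof (rule cSUP_least)
  fix t :: real assume t: "t \<in> {0..1}"
  show "\<bar>real (\<omega> t) / c - pi_lam lam t\<bar> \<le> 2 * \<eta>"
  proof (cases "t = 1")
    case True
    then show ?thesis using close[of m] m by simp
  next
    case False
    define k where "k = nat \<lfloor>t * real m\<rfloor>"
    have k: "real k \<le> t * real m" "t * real m < real k + 1"
      using t by (auto simp: k_def of_nat_nat)
    \<comment> \<open>The endpoint 1 was treated separately so that the next grid point
      \<open>Suc k\<close> still lies in the interval.\<close>
    have "t * real m < 1 * real m" using False t m by (intro mult_strict_right_mono) auto
    then have "k < m" using k by linarith
    have lo: "real k / real m \<le> t" and hi: "t \<le> real (Suc k) / real m"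
      using k m by (auto simp: field_simps)
    have "real (\<omega> (real k / real m)) / c \<le> real (\<omega> t) / c" "real (\<omega> t) / c \<le> real (\<omega> (real (Suc k) / real m)) / c"
      using Omega_mono[OF \<omega> lo] Omega_mono[OF \<omega> hi] c by (auto intro!: divide_right_mono)
    moreover have "pi_lam lam (real k / real m) \<le> pi_lam lam t" "pi_lam lam t \<le> pi_lam lam (real (Suc k) / real m)"
      using pi_lam_mono lo hi by auto
    ultimately show ?thesis
      using close[of k] close[of "Suc k"] mesh[of k] \<open>k < m\<close> by auto
  qed
qed auto

lemma pi_lam_mesh:
  assumes "\<eta> > 0"
  obtains m :: nat where "m > 0"
    "\<And>k. k < m \<Longrightarrow> pi_lam lam (real (Suc k) / real m) - pi_lam lam (real k / real m) \<le> \<eta>"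
proof -
  have "uniformly_continuous_on {0..1} (pi_lam lam)"
    by (intro compact_uniformly_continuous pi_lam_continuous) auto
  then obtain d where d: "d > 0" "\<And>x y. x \<in> {0..1} \<Longrightarrow> y \<in> {0..1} \<Longrightarrow> dist y x < d \<Longrightarrow>
      dist (pi_lam lam y) (pi_lam lam x) < \<eta>"
    using assms unfolding uniformly_continuous_on_def by metis
  obtain m where m: "inverse (real (Suc m)) < d" using reals_Archimedean[OF d(1)] by blast
  have "pi_lam lam (real (Suc k) / real (Suc m)) - pi_lam lam (real k / real (Suc m)) \<le> \<eta>" if "k < Suc m" for k
  proof -
    have "real (Suc k) / real (Suc m) - real k / real (Suc m) = inverse (real (Suc m))"
      by (simp add: field_simps)
    then have "dist (real (Suc k) / real (Suc m)) (real k / real (Suc m)) < d"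
      using m by (simp add: dist_real_def)
    then have "dist (pi_lam lam (real (Suc k) / real (Suc m))) (pi_lam lam (real k / real (Suc m))) < \<eta>"
      using that by (intro d(2)) auto
    then show ?thesis by (simp add: dist_real_def)
  qed
  then show ?thesis using that[of "Suc m"] by simp
qed

section \<open>Estimates for the bridges from a bound on the reciprocal characteristic\<close>

locale reciprocal_counting = markov_counting +
  fixes l' :: "nat \<Rightarrow> real \<Rightarrow> real" and lam :: real and \<delta> :: "nat \<Rightarrow> real"
  assumes l': "\<And>z t. t \<in> {0..1} \<Longrightarrow> ((\<lambda>s. l s z) has_real_derivative l' z t) (at t within {0..1})"
    and \<delta>: "\<And>z t. t \<in> {0..1} \<Longrightarrow> \<bar>Xi l t z - lam\<bar> \<le> \<delta> z"
begin

text \<open>The value that the probability of starting at 0 and ending at \<open>N\<close> takes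
  when every \<open>\<delta> j\<close> is 0; it cancels between numerator and denominator of the
  bridge probability.\<close>

definition bridge_mass :: "nat \<Rightarrow> real" where
  "bridge_mass N = measure P {\<omega>\<in>Omega. \<omega> 0 = 0} * (\<Prod>j<N. l 0 j / pi_speed lam) / fact N * exp (- cum N 1)"

lemma bridge_prob_lower:
  "bridge_mass N * exp (- (\<Sum>j<N. \<delta> j)) \<le> measure P {\<omega>\<in>Omega. \<omega> 0 = 0 \<and> \<omega> 1 = N}"
proof -
  let ?A = "{\<omega>\<in>Omega. \<omega> 0 = 0}"
  have A: "?A \<in> Fsig 0" by (rule Fsig_level) auto
  have "measure P ?A * prod (\<lambda>j. l 0 j / pi_speed lam * exp (- \<delta> j)) {..<N} / fact N
      \<le> measure P (?A \<inter> {\<omega>\<in>Omega. \<omega> 1 = N}) * exp (cum N 1)"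
    using transition_bounds(1)[OF _ A, of 0 1 l' lam \<delta> N] l' \<delta> by (simp add: cum_def atLeast0LessThan)
  also have "?A \<inter> {\<omega>\<in>Omega. \<omega> 1 = N} = {\<omega>\<in>Omega. \<omega> 0 = 0 \<and> \<omega> 1 = N}" by auto
  finally have "measure P ?A * prod (\<lambda>j. l 0 j / pi_speed lam * exp (- \<delta> j)) {..<N} / fact N * exp (- cum N 1)
      \<le> measure P {\<omega>\<in>Omega. \<omega> 0 = 0 \<and> \<omega> 1 = N} * exp (cum N 1) * exp (- cum N 1)"
    by (intro mult_right_mono) auto
  then have "measure P ?A * prod (\<lambda>j. l 0 j / pi_speed lam * exp (- \<delta> j)) {..<N} / fact N * exp (- cum N 1)
      \<le> measure P {\<omega>\<in>Omega. \<omega> 0 = 0 \<and> \<omega> 1 = N}"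
    by (simp only: mult.assoc exp_minus_inverse mult_1_right)
  moreover have "prod (\<lambda>j. l 0 j / pi_speed lam * exp (- \<delta> j)) {..<N} =
      (\<Prod>j<N. l 0 j / pi_speed lam) * exp (- (\<Sum>j<N. \<delta> j))"
    by (simp only: prod.distrib exp_sum[symmetric] finite_lessThan sum_negf)
  ultimately show ?thesis
    by (simp add: bridge_mass_def mult_ac)
qed

text \<open>The upper transition bound is chained through time \<open>u\<close>. The powers of
  \<open>pi_lam lam u\<close> and its complement, with the two factorials, form a binomial weight
  over \<open>fact N\<close>, and the level factors of the two pieces combine into one product over
  all \<open>j < N\<close>.\<close>

lemma bridge_prob_upper:
  assumes u: "u \<in> {0..1}" and n: "n \<le> N"
  shows "measure P {\<omega>\<in>Omega. \<omega> 0 = 0 \<and> \<omega> u = n \<and> \<omega> 1 = N} \<le>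
    bridge_mass N * exp (\<Sum>j<N. \<delta> j) * pmf (binomial_pmf N (pi_lam lam u)) n"
proof -
  let ?A = "{\<omega>\<in>Omega. \<omega> 0 = 0}" and ?B = "{\<omega>\<in>Omega. \<omega> 0 = 0 \<and> \<omega> u = n}"
  define b where "b j = l 0 j / pi_speed lam * exp (\<delta> j)" for j
  define p where "p = pi_lam lam u"
  have p: "0 \<le> p" "p \<le> 1" using pi_lam_in[OF u] by (auto simp: p_def)
  have b: "0 \<le> b j" for j using l_pos[of 0 j] pi_speed_pos[of lam] by (simp add: b_def)
  have A: "?A \<in> Fsig 0" by (rule Fsig_level) auto
  have "?B = ?A \<inter> {\<omega>\<in>Omega. \<omega> u = n}" by auto
  then have B: "?B \<in> Fsig u"
    using u Fsig.Int[OF Fsig_level[of 0 u "\<lambda>x. x = 0"] Fsig_level[of u u "\<lambda>x. x = n"]] by auto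
  have "measure P (?A \<inter> {\<omega>\<in>Omega. \<omega> u = n}) * exp (cum n u) \<le> measure P ?A * prod b {0..<n} * p ^ n / fact n"
    using transition_bounds(2)[OF _ A, of 0 u l' lam \<delta> n] l' \<delta> u by (simp add: cum_def b_def[abs_def] p_def)
  then have 1: "measure P ?B * exp (cum n u) \<le> measure P ?A * prod b {0..<n} * p ^ n / fact n"
    using \<open>?B = _\<close> by simp
  \<comment> \<open>The gauged mass \<open>measure P ?B * exp (cum n u)\<close> at the end of the
    first piece is exactly the initial value of the second.\<close>
  have "measure P (?B \<inter> {\<omega>\<in>Omega. \<omega> 1 = N}) * exp (cum N 1) \<le>
      measure P ?B * exp (cum n u) * prod b {n..<N} * (1 - p) ^ (N - n) / fact (N - n)"
    using transition_bounds(2)[OF _ B, of n 1 l' lam \<delta> "N - n"] l' \<delta> u n by (simp add: b_def[abs_def] p_def)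
  also have "?B \<inter> {\<omega>\<in>Omega. \<omega> 1 = N} = {\<omega>\<in>Omega. \<omega> 0 = 0 \<and> \<omega> u = n \<and> \<omega> 1 = N}" by auto
  also have "measure P ?B * exp (cum n u) * prod b {n..<N} * (1 - p) ^ (N - n) / fact (N - n) \<le>
      measure P ?A * prod b {0..<n} * p ^ n / fact n * prod b {n..<N} * (1 - p) ^ (N - n) / fact (N - n)"
    using 1 b p by (intro divide_right_mono mult_right_mono) (auto intro!: prod_nonneg)
  also have "\<dots> = measure P ?A * prod b {..<N} * (p ^ n * (1 - p) ^ (N - n) / (fact n * fact (N - n)))"
    using prod.atLeastLessThan_concat[of 0 n N b] n by (simp add: atLeast0LessThan field_simps)
  also have "p ^ n * (1 - p) ^ (N - n) / (fact n * fact (N - n)) = pmf (binomial_pmf N p) n / fact N"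
    using n p by (simp add: binomial_fact)
  finally have "measure P {\<omega>\<in>Omega. \<omega> 0 = 0 \<and> \<omega> u = n \<and> \<omega> 1 = N} * exp (cum N 1) * exp (- cum N 1) \<le>
     measure P ?A * prod b {..<N} * (pmf (binomial_pmf N p) n / fact N) * exp (- cum N 1)"
    by (intro mult_right_mono) auto
  then have "measure P {\<omega>\<in>Omega. \<omega> 0 = 0 \<and> \<omega> u = n \<and> \<omega> 1 = N} \<le>
     measure P ?A * prod b {..<N} * (pmf (binomial_pmf N p) n / fact N) * exp (- cum N 1)"
    by (simp only: mult.assoc exp_minus_inverse mult_1_right)
  moreover have "prod b {..<N} = (\<Prod>j<N. l 0 j / pi_speed lam) * exp (\<Sum>j<N. \<delta> j)"
    unfolding b_def by (simp only: prod.distrib exp_sum finite_lessThan)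
  ultimately show ?thesis
    by (simp add: bridge_mass_def p_def mult_ac)
qed

text \<open>Numerator and denominator each lose a factor \<open>exp (\<Sum>j<N. \<delta> j)\<close>
  against the binomial law, whose tail obeys Hoeffding's inequality.\<close>

lemma bridge_tail:
  assumes u: "u \<in> {0..1}" and N: "N > 0" and \<eta>: "\<eta> \<ge> 0"
    and init: "measure P {\<omega>\<in>Omega. \<omega> 0 = 0} > 0"
  shows "bridge_prob P N {\<omega>\<in>Omega. \<eta> \<le> \<bar>real (\<omega> u) / real N - pi_lam lam u\<bar>}
    \<le> 2 * exp (2 * (\<Sum>j<N. \<delta> j) - 2 * real N * \<eta>\<^sup>2)"
proof -
  define p where "p = pi_lam lam u"
  define D where "D = (\<Sum>j<N. \<delta> j)"
  define S where "S = {n. n \<le> N \<and> \<eta> \<le> \<bar>real n / real N - p\<bar>}"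
  let ?W = "\<lambda>n. {\<omega>\<in>Omega. \<omega> 0 = 0 \<and> \<omega> u = n \<and> \<omega> 1 = N}"
  let ?bad = "{\<omega>\<in>Omega. \<eta> \<le> \<bar>real (\<omega> u) / real N - p\<bar>} \<inter> {\<omega>\<in>Omega. \<omega> 0 = 0 \<and> \<omega> 1 = N}"
  have p: "p \<in> {0..1}" using pi_lam_in[OF u] by (simp add: p_def)
  have fin: "finite S" by (simp add: S_def)
  have Z: "0 < bridge_mass N"
    unfolding bridge_mass_def using l_pos[of 0] pi_speed_pos[of lam] init
    by (intro mult_pos_pos divide_pos_pos prod_pos) auto
  have W: "?W n \<in> sets P" for n
  proof -
    have "{\<omega>\<in>Omega. \<omega> 0 = 0} \<inter> ({\<omega>\<in>Omega. \<omega> u = n} \<inter> {\<omega>\<in>Omega. \<omega> 1 = N}) \<in> sets P"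
      using u by (intro sets.Int level_sets) auto
    also have "{\<omega>\<in>Omega. \<omega> 0 = 0} \<inter> ({\<omega>\<in>Omega. \<omega> u = n} \<inter> {\<omega>\<in>Omega. \<omega> 1 = N}) = ?W n" by auto
    finally show ?thesis .
  qed
  \<comment> \<open>Monotone paths ending at \<open>N\<close> take only values up to
    \<open>N\<close> at time \<open>u\<close>, so finitely many cases suffice.\<close>
  have "?bad \<subseteq> (\<Union>n\<in>S. ?W n)"
    using Omega_mono[of _ u 1] u by (auto simp: S_def)
  then have "measure P ?bad \<le> measure P (\<Union>n\<in>S. ?W n)"
    using W fin by (intro finite_measure_mono) auto
  also have "\<dots> \<le> (\<Sum>n\<in>S. measure P (?W n))"
    using W fin by (intro finite_measure_subadditive_finite) auto
  also have "\<dots> \<le> (\<Sum>n\<in>S. bridge_mass N * exp D * pmf (binomial_pmf N p) n)"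
    unfolding D_def p_def by (intro sum_mono bridge_prob_upper u) (auto simp: S_def)
  also have "\<dots> = bridge_mass N * exp D * measure_pmf.prob (binomial_pmf N p) S"
    using fin by (simp add: sum_distrib_left measure_measure_pmf_finite)
  also have "\<dots> \<le> bridge_mass N * exp D * (2 * exp (- 2 * real N * \<eta>\<^sup>2))"
  proof (rule mult_left_mono)
    have "measure_pmf.prob (binomial_pmf N p) S \<le> measure_pmf.prob (binomial_pmf N p) {n. \<eta> \<le> \<bar>real n / real N - p\<bar>}"
      by (intro measure_pmf.finite_measure_mono) (auto simp: S_def)
    also have "\<dots> \<le> 2 * exp (- 2 * real N * \<eta>\<^sup>2)"
      using binomial_distribution.prob_abs_ge'[of p N \<eta>] p N \<eta> by (simp add: binomial_distribution_def)
    finally show "measure_pmf.prob (binomial_pmf N p) S \<le> 2 * exp (- 2 * real N * \<eta>\<^sup>2)" .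
  qed (use Z in simp)
  finally have num: "measure P ?bad \<le> bridge_mass N * exp D * (2 * exp (- 2 * real N * \<eta>\<^sup>2))" .
  have den: "bridge_mass N * exp (- D) \<le> measure P {\<omega>\<in>Omega. \<omega> 0 = 0 \<and> \<omega> 1 = N}"
    unfolding D_def by (rule bridge_prob_lower)
  have "bridge_prob P N {\<omega>\<in>Omega. \<eta> \<le> \<bar>real (\<omega> u) / real N - p\<bar>} \<le>
      (bridge_mass N * exp D * (2 * exp (- 2 * real N * \<eta>\<^sup>2))) / (bridge_mass N * exp (- D))"
    unfolding bridge_prob_def using num den Z by (intro frac_le) auto
  also have "\<dots> = 2 * (exp D * exp D * exp (- 2 * real N * \<eta>\<^sup>2))"
    using Z by (simp add: exp_minus field_simps)
  also have "\<dots> = 2 * exp (2 * D - 2 * real N * \<eta>\<^sup>2)"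
    unfolding exp_add[symmetric] by (simp add: algebra_simps)
  finally show ?thesis by (simp add: p_def D_def)
qed

lemma bridge_tail_tendsto:
  assumes u: "u \<in> {0..1}" and \<eta>: "\<eta> > 0" and lim: "\<delta> \<longlonglongrightarrow> 0"
    and init: "measure P {\<omega>\<in>Omega. \<omega> 0 = 0} > 0"
  shows "(\<lambda>N. bridge_prob P N {\<omega>\<in>Omega. \<eta> \<le> \<bar>real (\<omega> u) / real N - pi_lam lam u\<bar>}) \<longlonglongrightarrow> 0"
proof (rule Lim_null_comparison)
  \<comment> \<open>With this constant the loss \<open>2 * (\<Sum>j<N. \<delta> j)\<close> uses up
    half of the Hoeffding exponent; the other half leaves geometric decay.\<close>
  have "eventually (\<lambda>N. (\<Sum>j<N. \<delta> j) \<le> \<eta>\<^sup>2 / 2 * real N) sequentially"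
    using \<eta> by (intro cesaro_le lim) auto
  then show "eventually (\<lambda>N. norm (bridge_prob P N {\<omega>\<in>Omega. \<eta> \<le> \<bar>real (\<omega> u) / real N - pi_lam lam u\<bar>})
      \<le> 2 * exp (- (\<eta>\<^sup>2)) ^ N) sequentially"
    using eventually_gt_at_top[of 0]
  proof eventually_elim
    case (elim N)
    have "0 \<le> bridge_prob P N {\<omega>\<in>Omega. \<eta> \<le> \<bar>real (\<omega> u) / real N - pi_lam lam u\<bar>}"
      by (simp add: bridge_prob_def)
    moreover have "bridge_prob P N {\<omega>\<in>Omega. \<eta> \<le> \<bar>real (\<omega> u) / real N - pi_lam lam u\<bar>}
      \<le> 2 * exp (2 * (\<Sum>j<N. \<delta> j) - 2 * real N * \<eta>\<^sup>2)"
      using elim \<eta> init by (intro bridge_tail u) auto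
    moreover have "2 * (\<Sum>j<N. \<delta> j) - 2 * real N * \<eta>\<^sup>2 \<le> real N * (- (\<eta>\<^sup>2))"
      using elim by (simp add: algebra_simps)
    then have "exp (2 * (\<Sum>j<N. \<delta> j) - 2 * real N * \<eta>\<^sup>2) \<le> exp (- (\<eta>\<^sup>2)) ^ N"
      unfolding exp_of_nat_mult[symmetric] by simp
    ultimately show ?case by simp
  qed
  have "(\<lambda>N. exp (- (\<eta>\<^sup>2)) ^ N) \<longlonglongrightarrow> 0" using \<eta> by (intro LIMSEQ_power_zero) auto
  then show "(\<lambda>N. 2 * exp (- (\<eta>\<^sup>2)) ^ N) \<longlonglongrightarrow> 0" by (rule tendsto_mult_right_zero)
qed

lemma bridge_sup_tendsto:
  assumes \<epsilon>: "\<epsilon> > 0" and lim: "\<delta> \<longlonglongrightarrow> 0" and init: "measure P {\<omega>\<in>Omega. \<omega> 0 = 0} > 0"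
  shows "(\<lambda>N. bridge_prob P N
     {\<omega>\<in>Omega. (SUP t\<in>{0..1}. \<bar>real (\<omega> t) / real N - pi_lam lam t\<bar>) \<ge> \<epsilon>}) \<longlonglongrightarrow> 0"
proof -
  \<comment> \<open>One third rather than one half makes \<open>2 * \<eta> < \<epsilon>\<close>
    strict, which is needed to contradict a supremum of at least \<open>\<epsilon>\<close>.\<close>
  define \<eta> where "\<eta> = \<epsilon> / 3"
  have \<eta>: "\<eta> > 0" "2 * \<eta> < \<epsilon>" using \<epsilon> by (auto simp: \<eta>_def)
  obtain m :: nat where m: "m > 0"
    "\<And>k. k < m \<Longrightarrow> pi_lam lam (real (Suc k) / real m) - pi_lam lam (real k / real m) \<le> \<eta>"
    using pi_lam_mesh[OF \<eta>(1), of lam] by metis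
  have u: "real k / real m \<in> {0..1}" if "k \<le> m" for k using that m(1) by auto
  let ?bad = "\<lambda>N. {\<omega>\<in>Omega. (SUP t\<in>{0..1}. \<bar>real (\<omega> t) / real N - pi_lam lam t\<bar>) \<ge> \<epsilon>}"
  let ?dev = "\<lambda>N k. {\<omega>\<in>Omega. \<eta> \<le> \<bar>real (\<omega> (real k / real m)) / real N - pi_lam lam (real k / real m)\<bar>}"
  have bound: "bridge_prob P N (?bad N) \<le> (\<Sum>k\<le>m. bridge_prob P N (?dev N k))" for N
  proof -
    let ?B = "{\<omega>\<in>Omega. \<omega> 0 = 0 \<and> \<omega> 1 = N}"
    have B: "?B \<in> sets P"
    proof -
      have "{\<omega>\<in>Omega. \<omega> 0 = 0} \<inter> {\<omega>\<in>Omega. \<omega> 1 = N} \<in> sets P"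
        by (intro sets.Int level_sets) auto
      also have "{\<omega>\<in>Omega. \<omega> 0 = 0} \<inter> {\<omega>\<in>Omega. \<omega> 1 = N} = ?B" by auto
      finally show ?thesis .
    qed
    have dev: "?dev N k \<inter> ?B \<in> sets P" if "k \<le> m" for k
      using level_sets[OF u[OF that]] B by (rule sets.Int)
    have "?bad N \<subseteq> (\<Union>k\<le>m. ?dev N k)"
    proof (rule subsetI, rule ccontr)
      fix \<omega> assume \<omega>: "\<omega> \<in> ?bad N" "\<omega> \<notin> (\<Union>k\<le>m. ?dev N k)"
      have "(SUP t\<in>{0..1}. \<bar>real (\<omega> t) / real N - pi_lam lam t\<bar>) \<le> 2 * \<eta>"
        using \<omega> m by (intro sup_deviation_grid[where m = m]) force+
      then show False using \<omega>(1) \<eta>(2) by auto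
    qed
    \<comment> \<open>Monotonicity of the measure asks only the covering union to be measurable, so
      measurability of the supremum event need not be shown.\<close>
    then have "measure P (?bad N \<inter> ?B) \<le> measure P (\<Union>k\<le>m. ?dev N k \<inter> ?B)"
      using dev by (intro finite_measure_mono sets.finite_UN) (blast, auto)
    also have "\<dots> \<le> (\<Sum>k\<le>m. measure P (?dev N k \<inter> ?B))"
      using dev by (intro finite_measure_subadditive_finite) auto
    finally show ?thesis
      unfolding bridge_prob_def sum_divide_distrib[symmetric] by (intro divide_right_mono) auto
  qed
  show ?thesis
  proof (rule Lim_null_comparison)
    show "eventually (\<lambda>N. norm (bridge_prob P N (?bad N)) \<le> (\<Sum>k\<le>m. bridge_prob P N (?dev N k))) sequentially"
      using bound by (intro always_eventually allI) (simp add: bridge_prob_def)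
    have "(\<lambda>N. \<Sum>k\<le>m. bridge_prob P N (?dev N k)) \<longlonglongrightarrow> (\<Sum>k\<le>m. 0)"
      using u by (intro tendsto_sum bridge_tail_tendsto \<eta>(1) lim init) auto
    then show "(\<lambda>N. \<Sum>k\<le>m. bridge_prob P N (?dev N k)) \<longlonglongrightarrow> 0" by simp
  qed
qed

end

theorem theorem2p5:
  fixes P :: "path measure" and l :: "real \<Rightarrow> nat \<Rightarrow> real" and lam \<epsilon> :: real
  assumes proc: "counting_process P l"
    and C1: "\<forall>z. \<exists>l'. continuous_on {0..1} l' \<and>
               (\<forall>t\<in>{0..1}. ((\<lambda>s. l s z) has_real_derivative l' t) (at t within {0..1}))"
    and bdd: "\<exists>C. \<forall>t\<in>{0..1}. \<forall>z. \<bar>l t (Suc z) - l t z\<bar> \<le> C"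
    and pos: "\<forall>t\<in>{0..1}. \<forall>z. l t z > 0"
    and init: "\<forall>k. measure P {\<omega>\<in>Omega. \<omega> 0 = k} > 0"
    and lim: "(\<lambda>z. SUP t\<in>{0..1}. \<bar>Xi l t z - lam\<bar>) \<longlonglongrightarrow> 0"
    and eps: "\<epsilon> > 0"
  shows "(\<lambda>N. bridge_prob P N
            {\<omega>\<in>Omega. (SUP t\<in>{0..1}. \<bar>real (\<omega> t) / real N - pi_lam lam t\<bar>) \<ge> \<epsilon>})
         \<longlonglongrightarrow> 0"
proof -
  obtain l' where l': "\<And>z. continuous_on {0..1} (l' z)"
    "\<And>z t. t \<in> {0..1} \<Longrightarrow> ((\<lambda>s. l s z) has_real_derivative l' z t) (at t within {0..1})"
    using C1 by metis
  have l_cont: "continuous_on {0..1} (\<lambda>s. l s z)" for z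
    using l'(2) by (rule DERIV_continuous_on)
  interpret markov_counting l P
    using l_cont pos proc by unfold_locales auto
  \<comment> \<open>A real supremum dominates its members only if the set is bounded above.
    Continuity of \<open>Xi\<close> in time, from the continuous derivative of the intensity,
    provides this, so the supremum can serve as \<open>\<delta>\<close>.\<close>
  have "bdd_above ((\<lambda>t. \<bar>Xi l t z - lam\<bar>) ` {0..1})" for z
  proof -
    have "l x z \<noteq> 0" if "x \<in> {0..1}" for x using l_pos[OF that, of z] by simp
    then have "continuous_on {0..1} (\<lambda>x. \<bar>l' z x / l x z + l x (Suc z) - l x z - lam\<bar>)"
      by (intro continuous_intros l'(1) l_cont) auto
    then have "continuous_on {0..1} (\<lambda>x. \<bar>Xi l x z - lam\<bar>)"
      by (rule continuous_on_eq) (simp add: Xi_eq[OF _ l'(2)])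
    then show ?thesis
      by (intro bounded_imp_bdd_above compact_imp_bounded compact_continuous_image) auto
  qed
  then interpret reciprocal_counting l P l' lam "\<lambda>z. SUP t\<in>{0..1}. \<bar>Xi l t z - lam\<bar>"
    using l'(2) by unfold_locales (auto intro: cSUP_upper)
  show ?thesis
    using bridge_sup_tendsto[OF eps lim] init by auto
qed

end
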